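(* Let $g_n$ be the number of strongly graded $(\mathbf{3+1})$-avoiding posets on the vertex set $[n]$, let $w_n$ be the number of weakly graded $(\mathbf{3+1})$-avoiding posets on $[n]$, and let $\psi_n=\sum_{i=0}^n \frac{2^{i(n-i)}}{i!\,(n-i)!}$. Then, as $n\to\infty$, $$g_n\sim w_n\sim n!\,\psi_n.$$
   Context: All posets are finite; a poset on $[n]=\{1,\dots,n\}$ is a partial order on this labeled set, and distinct order relations give distinct posets. A poset $P$ is weakly graded if there is a function $\operatorname{rk}:P\to\mathbb{N}$ such that $\operatorname{rk}(b)=\operatorname{rk}(a)+1$ whenever $b$ covers $a$, and such that the minimum value of $\operatorname{rk}$ on each connected component of $P$ is $0$. A weakly graded poset is strongly graded if all its minimal elements have the same rank and all its maximal elements have the same rank. A poset is $(\mathbf{3+1})$-avoiding if there are no four elements $x,y,z,w$ with $x<y<z$ and $w$ incomparable to each of $x,y,z$. *)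

theory Defs
  imports Complex_Main "HOL-Library.Landau_Symbols"
begin

text \<open>A poset on \<open>A\<close> is a reflexive order relation \<open>r\<close> with \<^term>\<open>partial_order_on A r\<close>; \<open>(a, b) \<in> r\<close>
  means \<open>a \<le> b\<close>. The predicates below are meant for such an \<open>r\<close>.\<close>

definition strictly_below :: "'a rel \<Rightarrow> 'a \<Rightarrow> 'a \<Rightarrow> bool" where
  "strictly_below r a b \<longleftrightarrow> (a, b) \<in> r \<and> a \<noteq> b"

definition incomparable :: "'a rel \<Rightarrow> 'a \<Rightarrow> 'a \<Rightarrow> bool" where
  "incomparable r a b \<longleftrightarrow> (a, b) \<notin> r \<and> (b, a) \<notin> r"

text \<open>\<open>covers r b a\<close>: the element \<open>b\<close> covers \<open>a\<close>.\<close>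

definition covers :: "'a rel \<Rightarrow> 'a \<Rightarrow> 'a \<Rightarrow> bool" where
  "covers r b a \<longleftrightarrow>
     strictly_below r a b \<and> (\<nexists>c. strictly_below r a c \<and> strictly_below r c b)"

definition minimal_elements :: "'a set \<Rightarrow> 'a rel \<Rightarrow> 'a set" where
  "minimal_elements A r = {x \<in> A. \<nexists>y. y \<in> A \<and> strictly_below r y x}"

definition maximal_elements :: "'a set \<Rightarrow> 'a rel \<Rightarrow> 'a set" where
  "maximal_elements A r = {x \<in> A. \<nexists>y. y \<in> A \<and> strictly_below r x y}"

text \<open>The connected components are the classes of the equivalence relation generated by
  comparability. For finite posets they are also the components of the Hasse diagram.\<close>

definition poset_components :: "'a set \<Rightarrow> 'a rel \<Rightarrow> 'a set set" where
  "poset_components A r = A // (r \<union> r\<inverse>)\<^sup>*"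

definition rank_function :: "'a set \<Rightarrow> 'a rel \<Rightarrow> ('a \<Rightarrow> nat) \<Rightarrow> bool" where
  "rank_function A r rk \<longleftrightarrow>
     (\<forall>a\<in>A. \<forall>b\<in>A. covers r b a \<longrightarrow> rk b = rk a + 1) \<and>
     (\<forall>C\<in>poset_components A r. Min (rk ` C) = 0)"

definition weakly_graded :: "'a set \<Rightarrow> 'a rel \<Rightarrow> bool" where
  "weakly_graded A r \<longleftrightarrow> (\<exists>rk. rank_function A r rk)"

text \<open>On a finite poset the rank function is unique on \<open>A\<close> when it exists, so the existential
  quantifier below refers to the rank function of \<open>r\<close>.\<close>

definition strongly_graded :: "'a set \<Rightarrow> 'a rel \<Rightarrow> bool" where
  "strongly_graded A r \<longleftrightarrow>
     (\<exists>rk. rank_function A r rk \<and>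
        (\<forall>x\<in>minimal_elements A r. \<forall>y\<in>minimal_elements A r. rk x = rk y) \<and>
        (\<forall>x\<in>maximal_elements A r. \<forall>y\<in>maximal_elements A r. rk x = rk y))"

definition avoids_3_plus_1 :: "'a set \<Rightarrow> 'a rel \<Rightarrow> bool" where
  "avoids_3_plus_1 A r \<longleftrightarrow>
     \<not> (\<exists>x\<in>A. \<exists>y\<in>A. \<exists>z\<in>A. \<exists>w\<in>A.
          strictly_below r x y \<and> strictly_below r y z \<and>
          incomparable r w x \<and> incomparable r w y \<and> incomparable r w z)"

definition num_strongly_graded :: "nat \<Rightarrow> nat" where
  "num_strongly_graded n =
     card {r. partial_order_on {1..n} r \<and> strongly_graded {1..n} r \<and> avoids_3_plus_1 {1..n} r}"

definition num_weakly_graded :: "nat \<Rightarrow> nat" where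
  "num_weakly_graded n =
     card {r. partial_order_on {1..n} r \<and> weakly_graded {1..n} r \<and> avoids_3_plus_1 {1..n} r}"

definition psi :: "nat \<Rightarrow> real" where
  "psi n = (\<Sum>i=0..n. 2 ^ (i * (n - i)) / (fact i * fact (n - i)))"

end

(*
  Let b_n = n! psi_n, the number of graphs from a set S of [n] to its complement. By Pascal's rule
  b_n = sum_i C(n-1,i) 2^(i(n-1-i)) (2^i + 2^(n-1-i)), so b_n >= 2^(n/2) b_(n-1).
  A bipartite graph without isolated vertices is a strongly graded poset, and at most 2n b_(n-1)
  graphs have an isolated vertex; hence g_n >= (1 - o(1)) b_n.

  Conversely, posets without a 3-element chain embed into bipartite graphs. A graded (3+1)-avoiding
  poset with such a chain is connected, and elements whose ranks differ by at least 2 are comparable,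
  so it is encoded by its levels and the bipartite graphs between consecutive levels. Outside of two
  consecutive levels one can always delete one or two vertices that have few possible
  neighbourhoods: a vertex of low degree (2^(2n/5) options), a vertex joined to all or nothing of a
  level, or two vertices y, w of one level with D(y) <= D(w) and U(w) <= U(y) (3^(3n/5) options,
  against b_n / b_(n-2) of order 2^n). By induction the number of these encodings is o(b_n).
*)

theory Submission
  imports Defs "HOL-Library.FuncSet" "HOL-Real_Asymp.Real_Asymp"
begin

section \<open>Bipartite graphs\<close>

text \<open>The side \<open>S\<close> is part of the datum because the edges do not tell on which
  side an isolated vertex lies; counted this way the total is exactly
  \<open>fact n * psi n\<close>.\<close>

definition bip_graphs :: "'a set \<Rightarrow> ('a set \<times> 'a rel) set" where
  "bip_graphs A = Sigma (Pow A) (\<lambda>S. Pow (S \<times> (A - S)))"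

definition bip_count :: "nat \<Rightarrow> nat" where
  "bip_count n = (\<Sum>i\<le>n. (n choose i) * 2 ^ (i * (n - i)))"

lemma finite_bip_graphs: "finite A \<Longrightarrow> finite (bip_graphs A)"
  unfolding bip_graphs_def
  by (intro finite_SigmaI) (auto intro: finite_subset)

lemma sum_Pow_card:
  assumes "finite A"
  shows "(\<Sum>S\<in>Pow A. h (card S)) = (\<Sum>i\<le>card A. of_nat (card A choose i) * (h i :: 'b :: comm_semiring_1))"
proof -
  have "(\<Sum>S\<in>Pow A. h (card S)) = (\<Sum>i\<le>card A. \<Sum>S\<in>{S \<in> Pow A. card S = i}. h (card S))"
    using assms by (intro sum.group[symmetric]) (auto intro: card_mono)
  also have "\<dots> = (\<Sum>i\<le>card A. of_nat (card A choose i) * h i)"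
    using n_subsets[OF assms] by (intro sum.cong) auto
  finally show ?thesis .
qed

lemma card_bip_graphs:
  assumes "finite A"
  shows "card (bip_graphs A) = bip_count (card A)"
proof -
  have "card (bip_graphs A) = (\<Sum>S\<in>Pow A. card (Pow (S \<times> (A - S))))"
    unfolding bip_graphs_def using assms by (intro card_SigmaI) (auto intro: finite_subset)
  also have "\<dots> = (\<Sum>S\<in>Pow A. 2 ^ (card S * (card A - card S)))"
  proof (rule sum.cong)
    fix S assume "S \<in> Pow A"
    then have "finite S" "S \<subseteq> A" using assms finite_subset by auto
    then show "card (Pow (S \<times> (A - S))) = 2 ^ (card S * (card A - card S))"
      using assms by (simp add: card_Pow card_cartesian_product card_Diff_subset)
  qed simp
  also have "\<dots> = bip_count (card A)"
    unfolding bip_count_def using sum_Pow_card[OF assms, of "\<lambda>i. 2 ^ (i * (card A - i)) :: nat"] by simp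
  finally show ?thesis .
qed

lemma bip_count_psi: "real (bip_count n) = fact n * psi n"
proof -
  have "fact n * (2 ^ (i * (n - i)) / (fact i * fact (n - i))) = real ((n choose i) * 2 ^ (i * (n - i)))"
    if "i \<le> n" for i
    using that by (simp add: binomial_fact)
  then show ?thesis
    unfolding bip_count_def psi_def by (simp add: sum_distrib_left atLeast0AtMost)
qed

section \<open>Growth of the bipartite counts\<close>

lemma bip_count_pos: "bip_count n \<ge> 1"
proof -
  have "(n choose 0) * 2 ^ (0 * (n - 0)) \<le> bip_count n"
    unfolding bip_count_def by (rule member_le_sum) auto
  then show ?thesis by simp
qed

text \<open>Pascal's rule: a new vertex enters the second side with \<open>2 ^ i\<close> possible
  neighbourhoods or the first side with \<open>2 ^ (m - i)\<close>.\<close>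

lemma bip_count_Suc:
  "bip_count (Suc m) = (\<Sum>i\<le>m. (m choose i) * 2 ^ (i * (m - i)) * (2 ^ i + 2 ^ (m - i)))"
proof -
  let ?h = "\<lambda>i. 2 ^ (i * (Suc m - i)) :: nat"
  have "bip_count (Suc m) = ?h 0 + (\<Sum>i\<le>m. (Suc m choose Suc i) * ?h (Suc i))"
    unfolding bip_count_def by (subst sum.atMost_Suc_shift) simp
  also have "\<dots> = ?h 0 + (\<Sum>i\<le>m. (m choose Suc i) * ?h (Suc i)) + (\<Sum>i\<le>m. (m choose i) * ?h (Suc i))"
    by (simp add: algebra_simps sum.distrib)
  also have "?h 0 + (\<Sum>i\<le>m. (m choose Suc i) * ?h (Suc i)) = (\<Sum>i\<le>Suc m. (m choose i) * ?h i)"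
    by (subst sum.atMost_Suc_shift) simp
  also have "\<dots> = (\<Sum>i\<le>m. (m choose i) * ?h i)"
    by simp
  also have "\<dots> + (\<Sum>i\<le>m. (m choose i) * ?h (Suc i)) =
      (\<Sum>i\<le>m. (m choose i) * 2 ^ (i * (m - i)) * (2 ^ i + 2 ^ (m - i)))"
    unfolding sum.distrib[symmetric]
  proof (rule sum.cong)
    fix i assume "i \<in> {..m}"
    then have "?h i = 2 ^ (i * (m - i)) * 2 ^ i" "?h (Suc i) = 2 ^ (i * (m - i)) * 2 ^ (m - i)"
      by (simp_all add: power_add[symmetric] Suc_diff_le)
    then show "(m choose i) * ?h i + (m choose i) * ?h (Suc i)
        = (m choose i) * 2 ^ (i * (m - i)) * (2 ^ i + 2 ^ (m - i))"
      by (simp only: algebra_simps)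
  qed simp
  finally show ?thesis .
qed

text \<open>By AM-GM each factor in \<open>bip_count_Suc\<close> is at least
  \<open>2 * sqrt 2 ^ m\<close>; giving up a factor \<open>sqrt 2\<close> leaves a pure power of
  \<open>sqrt 2\<close>.\<close>

lemma bip_count_growth: "sqrt 2 ^ Suc m * real (bip_count m) \<le> real (bip_count (Suc m))"
proof -
  have amgm: "sqrt 2 ^ Suc m \<le> 2 ^ i + 2 ^ (m - i)" if "i \<le> m" for i
  proof -
    define x y where "x = sqrt 2 ^ i" and "y = sqrt 2 ^ (m - i)"
    have "0 < x" "0 < y" by (simp_all add: x_def y_def)
    have "sqrt 2 ^ m = x * y" using that by (simp add: x_def y_def power_add[symmetric])
    have "(2::real) ^ i = x^2" "(2::real) ^ (m - i) = y^2"
      unfolding x_def y_def by (simp_all add: power_mult[symmetric] mult.commute[of _ 2] power_mult)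
    have "sqrt 2 * (x * y) \<le> 2 * (x * y)"
      using \<open>0 < x\<close> \<open>0 < y\<close> sqrt2_less_2 by (intro mult_right_mono) auto
    also have "\<dots> \<le> x^2 + y^2" using sum_squares_bound[of x y] by simp
    finally show ?thesis
      using \<open>sqrt 2 ^ m = x * y\<close> \<open>2 ^ i = x^2\<close> \<open>2 ^ (m - i) = y^2\<close> by simp
  qed
  have "sqrt 2 ^ Suc m * real (bip_count m) =
      (\<Sum>i\<le>m. real ((m choose i) * 2 ^ (i * (m - i))) * sqrt 2 ^ Suc m)"
    unfolding bip_count_def of_nat_sum sum_distrib_left by (simp add: algebra_simps)
  also have "\<dots> \<le> (\<Sum>i\<le>m. real ((m choose i) * 2 ^ (i * (m - i))) * (2 ^ i + 2 ^ (m - i)))"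
    using amgm by (intro sum_mono mult_left_mono) auto
  also have "\<dots> = real (bip_count (Suc m))"
    unfolding bip_count_Suc by simp
  finally show ?thesis .
qed

lemma card_le_fibres:
  assumes "finite T" "\<pi> ` S \<subseteq> T" and "\<And>t. t \<in> T \<Longrightarrow> card {s \<in> S. \<pi> s = t} \<le> c"
  shows "card S \<le> c * card T"
proof -
  have "S = (\<Union>t\<in>T. {s \<in> S. \<pi> s = t})" using assms(2) by auto
  then have "card S \<le> (\<Sum>t\<in>T. card {s \<in> S. \<pi> s = t})"
    using card_UN_le[OF assms(1), of "\<lambda>t. {s \<in> S. \<pi> s = t}"] by simp
  also have "\<dots> \<le> (\<Sum>t\<in>T. c)" using assms(3) by (rule sum_mono)
  finally show ?thesis by (simp add: mult.commute)
qed

section \<open>Layered graphs and vertex deletion\<close>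

text \<open>The pairs \<open>(f, G)\<close> relax the encoding of a poset by its rank function \<open>f\<close> and its comparabilities
  \<open>G\<close> between consecutive ranks: empty levels and isolated vertices are allowed, which makes the family
  closed under deleting vertices. The last condition is what \<open>(3+1)\<close>-avoidance says about chains
  of consecutive ranks.\<close>

definition layered :: "'a set \<Rightarrow> nat \<Rightarrow> (('a \<Rightarrow> nat) \<times> 'a rel) set" where
  "layered A M = {(f, G). f \<in> A \<rightarrow>\<^sub>E {..M} \<and> G \<subseteq> {(a, b) \<in> A \<times> A. f b = f a + 1} \<and>
     (\<forall>y\<in>A. \<forall>w\<in>A. f y = f w \<longrightarrow> G\<inverse> `` {y} \<subseteq> G\<inverse> `` {w} \<or> G `` {y} \<subseteq> G `` {w})}"

lemma layeredD:
  assumes "(f, G) \<in> layered A M"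
  shows "f \<in> A \<rightarrow>\<^sub>E {..M}" "\<And>a b. (a, b) \<in> G \<Longrightarrow> a \<in> A \<and> b \<in> A \<and> f b = f a + 1"
    "\<And>y w. \<lbrakk>y \<in> A; w \<in> A; f y = f w\<rbrakk> \<Longrightarrow> G\<inverse> `` {y} \<subseteq> G\<inverse> `` {w} \<or> G `` {y} \<subseteq> G `` {w}"
  using assms unfolding layered_def by auto

lemma layered_subset: "layered A M \<subseteq> (A \<rightarrow>\<^sub>E {..M}) \<times> Pow (A \<times> A)"
  unfolding layered_def by auto

lemma finite_layered: "finite A \<Longrightarrow> finite (layered A M)"
  by (rule finite_subset[OF layered_subset]) (auto intro: finite_PiE)

lemma card_layered_trivial:
  assumes "finite A"
  shows "card (layered A M) \<le> (M + 1) ^ card A * 2 ^ (card A ^ 2)"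
proof -
  have "card (layered A M) \<le> card ((A \<rightarrow>\<^sub>E {..M}) \<times> Pow (A \<times> A))"
    using assms by (intro card_mono layered_subset finite_cartesian_product finite_PiE) auto
  also have "\<dots> = (M + 1) ^ card A * 2 ^ (card A ^ 2)"
    using assms by (simp add: card_cartesian_product card_Pow card_PiE power2_eq_square)
  finally show ?thesis .
qed

lemma layered_restrict:
  assumes "(f, G) \<in> layered A M" "B \<subseteq> A"
  shows "(restrict f B, G \<inter> B \<times> B) \<in> layered B M"
proof -
  note L = layeredD[OF assms(1)]
  have "(G \<inter> B \<times> B)\<inverse> `` {y} \<subseteq> (G \<inter> B \<times> B)\<inverse> `` {w} \<or> (G \<inter> B \<times> B) `` {y} \<subseteq> (G \<inter> B \<times> B) `` {w}"
    if "y \<in> B" "w \<in> B" "f y = f w" for y w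
    using L(3)[of y w] that assms(2) by blast
  moreover have "restrict f B \<in> B \<rightarrow>\<^sub>E {..M}"
    using L(1) assms(2) by auto
  ultimately show ?thesis
    using L(2) unfolding layered_def by (auto simp: restrict_def)
qed

text \<open>In a layered family all of whose members are constant on \<open>V\<close>, a member is determined by its
  restriction to \<open>A - V\<close>, the level of \<open>V\<close>, and the edges meeting \<open>V\<close>.\<close>

lemma card_by_removal:
  assumes "finite A" "V \<subseteq> A" "v \<in> V" "S \<subseteq> layered A M"
    and const: "\<And>f G u. (f, G) \<in> S \<Longrightarrow> u \<in> V \<Longrightarrow> f u = f v"
    and edges: "\<And>f G. (f, G) \<in> S \<Longrightarrow> \<exists>E. finite E \<and> card E \<le> c \<and>
      (\<forall>H. (f, H) \<in> S \<longrightarrow> H - (A - V) \<times> (A - V) \<in> E)"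
  shows "card S \<le> c * ((M + 1) * card (layered (A - V) M))"
proof -
  define B where "B = A - V"
  define \<pi> where "\<pi> = (\<lambda>(f, G). (f v :: nat, restrict f B, G \<inter> B \<times> B))"
  have "v \<in> A" using assms by auto
  have finB: "finite (layered B M)" using assms(1) by (simp add: B_def finite_layered)
  have "card S \<le> c * card ({..M} \<times> layered B M)"
  proof (rule card_le_fibres[where \<pi> = \<pi>])
    show "finite ({..M} \<times> layered B M)" using finB by simp
    show "\<pi> ` S \<subseteq> {..M} \<times> layered B M"
    proof clarify
      fix j f G H g assume *: "(f, G) \<in> S" "(j, g, H) = \<pi> (f, G)"
      then have L: "(f, G) \<in> layered A M" using assms(4) by auto
      have "f v \<le> M" using layeredD(1)[OF L] \<open>v \<in> A\<close> by auto
      then show "j \<in> {..M} \<and> (g, H) \<in> layered B M"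
        using * layered_restrict[OF L, of B] by (auto simp: \<pi>_def B_def)
    qed
    fix t assume "t \<in> {..M} \<times> layered B M"
    show "card {s \<in> S. \<pi> s = t} \<le> c"
    proof (cases "{s \<in> S. \<pi> s = t} = {}")
      case False
      then obtain f G where fG: "(f, G) \<in> S" "\<pi> (f, G) = t" by auto
      obtain E where E: "finite E" "card E \<le> c" "\<And>H. (f, H) \<in> S \<Longrightarrow> H - B \<times> B \<in> E"
        using edges[OF fG(1)] unfolding B_def by auto
      \<comment> \<open>\<open>E\<close> may depend on \<open>f\<close> because all members of a
        fibre share \<open>f\<close>: it is recorded on \<open>A - V\<close>, constant on
        \<open>V\<close> with a recorded value, and extensional off \<open>A\<close>.\<close>
      have same: "h = f \<and> H \<inter> B \<times> B = G \<inter> B \<times> B" if "(h, H) \<in> S" "\<pi> (h, H) = t" for h H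
      proof -
        have eq: "h v = f v" "restrict h B = restrict f B" "H \<inter> B \<times> B = G \<inter> B \<times> B"
          using that fG by (auto simp: \<pi>_def)
        have L: "(h, H) \<in> layered A M" "(f, G) \<in> layered A M" using that fG assms(4) by auto
        have "h x = f x" for x
        proof (cases "x \<in> A")
          case False
          then show ?thesis using layeredD(1)[OF L(1)] layeredD(1)[OF L(2)] by (auto simp: PiE_def extensional_def)
        next
          case True
          have "restrict h B x = restrict f B x" using eq(2) by simp
          with True eq(1) const[OF that(1)] const[OF fG(1)] show ?thesis
            by (cases "x \<in> V") (auto simp: B_def)
        qed
        then show ?thesis using eq by auto
      qed
      \<comment> \<open>The edges inside \<open>B \<times> B\<close> are fixed by the fibre, so the
        remaining ones determine the graph.\<close>
      have "inj_on (\<lambda>(h, H). H - B \<times> B) {s \<in> S. \<pi> s = t}"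
      proof (rule inj_onI, clarify)
        fix h H h' H' assume "(h, H) \<in> S" "t = \<pi> (h, H)" "(h', H') \<in> S" "\<pi> (h', H') = \<pi> (h, H)"
          and "H - B \<times> B = H' - B \<times> B"
        then show "h = h' \<and> H = H'" using same[of h H] same[of h' H'] by (metis Int_Diff_Un)
      qed
      moreover have "(\<lambda>(h, H). H - B \<times> B) ` {s \<in> S. \<pi> s = t} \<subseteq> E"
      proof clarify
        fix h H assume "(h, H) \<in> S" "t = \<pi> (h, H)"
        then show "H - B \<times> B \<in> E" using same[of h H] E(3)[of H] by simp
      qed
      ultimately have "card {s \<in> S. \<pi> s = t} \<le> card E" using E(1) by (rule card_inj_on_le)
      then show ?thesis using E(2) by simp
    next
      case True
      then show ?thesis by (metis card.empty le0)
    qed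
  qed
  then show ?thesis by (simp add: card_cartesian_product B_def)
qed

section \<open>Families in which a vertex or a pair is cheap to delete\<close>

definition above :: "'a set \<Rightarrow> ('a \<Rightarrow> nat) \<Rightarrow> 'a \<Rightarrow> 'a set" where
  "above A f v = {a \<in> A. f a = f v + 1}"

text \<open>The additive form avoids truncated subtraction: for a vertex on level 0 the set is
  empty.\<close>

definition below :: "'a set \<Rightarrow> ('a \<Rightarrow> nat) \<Rightarrow> 'a \<Rightarrow> 'a set" where
  "below A f v = {a \<in> A. f v = f a + 1}"

lemma finite_above: "finite A \<Longrightarrow> finite (above A f v)"
  by (simp add: above_def)

lemma finite_below: "finite A \<Longrightarrow> finite (below A f v)"
  by (simp add: below_def)

lemma layered_edges_at:
  assumes "(f, G) \<in> layered A M"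
  shows "G - (A - {v}) \<times> (A - {v}) = (G\<inverse> `` {v}) \<times> {v} \<union> {v} \<times> (G `` {v})"
    and "G\<inverse> `` {v} \<subseteq> below A f v" and "G `` {v} \<subseteq> above A f v"
  using layeredD(2)[OF assms] by (fastforce simp: above_def below_def)+

text \<open>The inequality bounds the number of possible neighbours and so involves \<open>f\<close>
  alone; one set of candidate edges serves all graphs over the same \<open>f\<close>.\<close>

definition low_degree where
  "low_degree A M v = {(f, G) \<in> layered A M. 5 * (card (above A f v) + card (below A f v)) \<le> 2 * card A}"

lemma card_low_degree:
  assumes "finite A" "v \<in> A"
  shows "card (low_degree A M v) \<le> 2 ^ (2 * card A div 5) * ((M + 1) * card (layered (A - {v}) M))"
proof (rule card_by_removal[where v = v])
  fix f G assume fG: "(f, G) \<in> low_degree A M v"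
  let ?D = "below A f v \<times> {v} \<union> {v} \<times> above A f v"
  have "finite ?D" using assms by (simp add: above_def below_def)
  have "card ?D \<le> card (above A f v) + card (below A f v)"
    using card_Un_le[of "below A f v \<times> {v}" "{v} \<times> above A f v"] by (simp add: card_cartesian_product)
  also have "\<dots> \<le> 2 * card A div 5"
    using fG by (auto simp: low_degree_def)
  finally have "card (Pow ?D) \<le> 2 ^ (2 * card A div 5)"
    using \<open>finite ?D\<close> by (simp add: card_Pow del: Un_iff)
  moreover have "H - (A - {v}) \<times> (A - {v}) \<in> Pow ?D" if "(f, H) \<in> low_degree A M v" for H
  proof -
    have L: "(f, H) \<in> layered A M" using that unfolding low_degree_def by blast
    show ?thesis
      unfolding Pow_iff layered_edges_at(1)[OF L, of v]
      using layered_edges_at(2,3)[OF L, of v] by blast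
  qed
  ultimately show "\<exists>E. finite E \<and> card E \<le> 2 ^ (2 * card A div 5) \<and>
      (\<forall>H. (f, H) \<in> low_degree A M v \<longrightarrow> H - (A - {v}) \<times> (A - {v}) \<in> E)"
    using \<open>finite ?D\<close> by (intro exI[of _ "Pow ?D"]) auto
qed (use assms in \<open>auto simp: low_degree_def\<close>)

definition bottom_uniform where
  "bottom_uniform A M v = {(f, G) \<in> layered A M. below A f v = {} \<and>
     (\<forall>y\<in>above A f v. \<forall>w\<in>above A f v. G\<inverse> `` {y} = G\<inverse> `` {w})}"

text \<open>All vertices above \<open>v\<close> agree on whether \<open>v\<close> is a lower
  neighbour, so \<open>v\<close> is joined to all of them or to none; this is the factor 2.\<close>

lemma card_bottom_uniform:
  assumes "finite A" "v \<in> A"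
  shows "card (bottom_uniform A M v) \<le> 2 * ((M + 1) * card (layered (A - {v}) M))"
proof (rule card_by_removal[where v = v])
  fix f G assume fG: "(f, G) \<in> bottom_uniform A M v"
  let ?E = "{{}, {v} \<times> above A f v}"
  have "H - (A - {v}) \<times> (A - {v}) \<in> ?E" if "(f, H) \<in> bottom_uniform A M v" for H
  proof -
    have L: "(f, H) \<in> layered A M" and H: "below A f v = {}"
      "\<And>y w. \<lbrakk>y \<in> above A f v; w \<in> above A f v\<rbrakk> \<Longrightarrow> H\<inverse> `` {y} = H\<inverse> `` {w}"
      using that unfolding bottom_uniform_def by blast+
    have "H `` {v} = {} \<or> H `` {v} = above A f v"
    proof (rule disjCI)
      assume "H `` {v} \<noteq> above A f v"
      then obtain w where w: "w \<in> above A f v" "(v, w) \<notin> H" using layered_edges_at(3)[OF L] by blast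
      show "H `` {v} = {}"
      proof (rule ccontr)
        assume "H `` {v} \<noteq> {}"
        then obtain y where "(v, y) \<in> H" by auto
        then show False using w H(2)[of y w] layered_edges_at(3)[OF L] by blast
      qed
    qed
    then show ?thesis using layered_edges_at[OF L, of v] H(1) by auto
  qed
  then show "\<exists>E. finite E \<and> card E \<le> 2 \<and>
      (\<forall>H. (f, H) \<in> bottom_uniform A M v \<longrightarrow> H - (A - {v}) \<times> (A - {v}) \<in> E)"
    by (intro exI[of _ ?E]) (auto simp: card_insert_if)
qed (use assms in \<open>unfold bottom_uniform_def, blast+\<close>)

definition top_uniform where
  "top_uniform A M v = {(f, G) \<in> layered A M. 5 * card (above A f v) \<le> card A \<and>
     (\<forall>y\<in>below A f v. \<forall>w\<in>below A f v. G `` {y} = G `` {w})}"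

text \<open>Downwards \<open>v\<close> is joined to the whole level or to nothing; upwards the
  choice is free, but at most a fifth of the vertices is available.\<close>

lemma card_top_uniform:
  assumes "finite A" "v \<in> A"
  shows "card (top_uniform A M v) \<le> (2 * 2 ^ (card A div 5)) * ((M + 1) * card (layered (A - {v}) M))"
proof (rule card_by_removal[where v = v])
  fix f G assume fG: "(f, G) \<in> top_uniform A M v"
  let ?T = "{{}, below A f v} \<times> Pow (above A f v)"
  let ?E = "(\<lambda>(X, Y). X \<times> {v} \<union> {v} \<times> Y) ` ?T"
  have le: "5 * card (above A f v) \<le> card A" using fG unfolding top_uniform_def by blast
  have "finite ?T" using assms by (simp add: above_def)
  have "card ?E \<le> card ?T" using \<open>finite ?T\<close> by (rule card_image_le)
  also have "\<dots> = card {{}, below A f v} * 2 ^ card (above A f v)"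
    using assms by (simp only: card_cartesian_product card_Pow finite_above)
  also have "\<dots> \<le> 2 * 2 ^ (card A div 5)"
    using le by (intro mult_mono power_increasing) (auto simp: card_insert_if)
  finally have "card ?E \<le> 2 * 2 ^ (card A div 5)" .
  moreover have "H - (A - {v}) \<times> (A - {v}) \<in> ?E" if "(f, H) \<in> top_uniform A M v" for H
  proof -
    have L: "(f, H) \<in> layered A M" and H:
      "\<And>y w. \<lbrakk>y \<in> below A f v; w \<in> below A f v\<rbrakk> \<Longrightarrow> H `` {y} = H `` {w}"
      using that unfolding top_uniform_def by blast+
    have "H\<inverse> `` {v} = {} \<or> H\<inverse> `` {v} = below A f v"
    proof (rule disjCI)
      assume "H\<inverse> `` {v} \<noteq> below A f v"
      then obtain w where w: "w \<in> below A f v" "(w, v) \<notin> H" using layered_edges_at(2)[OF L] by blast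
      show "H\<inverse> `` {v} = {}"
      proof (rule ccontr)
        assume "H\<inverse> `` {v} \<noteq> {}"
        then obtain y where "(y, v) \<in> H" by auto
        then show False using w H[of y w] layered_edges_at(2)[OF L] by blast
      qed
    qed
    then have "(H\<inverse> `` {v}, H `` {v}) \<in> ?T" using layered_edges_at(3)[OF L] by auto
    then show ?thesis
      unfolding layered_edges_at(1)[OF L, of v] by (rule rev_image_eqI) simp
  qed
  ultimately show "\<exists>E. finite E \<and> card E \<le> 2 * 2 ^ (card A div 5) \<and>
      (\<forall>H. (f, H) \<in> top_uniform A M v \<longrightarrow> H - (A - {v}) \<times> (A - {v}) \<in> E)"
    using \<open>finite ?T\<close> by (intro exI[of _ ?E]) blast
qed (use assms in \<open>unfold top_uniform_def, blast+\<close>)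

text \<open>Each element of \<open>D\<close> lies in both sets, only in the larger one, or in
  neither.\<close>

lemma card_nested_pairs:
  assumes "finite D"
  shows "card (SIGMA X : Pow D. Pow X) = 3 ^ card D"
proof -
  have "card (SIGMA X : Pow D. Pow X) = (\<Sum>X\<in>Pow D. card (Pow X))"
    using assms by (intro card_SigmaI) (auto intro: finite_subset)
  also have "\<dots> = (\<Sum>X\<in>Pow D. 2 ^ card X)"
    using assms by (intro sum.cong) (auto simp: card_Pow finite_subset)
  also have "\<dots> = (\<Sum>i\<le>card D. (card D choose i) * 2 ^ i)"
    using sum_Pow_card[OF assms, of "\<lambda>i. 2 ^ i :: nat"] by simp
  also have "\<dots> = 3 ^ card D"
    using binomial_ring[of "2::nat" 1 "card D"] by simp
  finally show ?thesis .
qed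

definition opposed_pair where
  "opposed_pair A M y w = {(f, G) \<in> layered A M. f y = f w \<and>
     5 * (card (above A f y) + card (below A f y)) \<le> 3 * card A \<and>
     G\<inverse> `` {y} \<subseteq> G\<inverse> `` {w} \<and> G `` {w} \<subseteq> G `` {y}}"

text \<open>Two unrelated vertices would have four ways to meet each vertex of an adjacent level;
  nested neighbourhoods leave three, over at most 3/5 of all vertices.\<close>

lemma card_opposed_pair:
  assumes "finite A" "y \<in> A" "w \<in> A"
  shows "card (opposed_pair A M y w) \<le>
    3 ^ (3 * card A div 5) * ((M + 1) * card (layered (A - {y, w}) M))"
proof (rule card_by_removal[where v = y])
  fix f G assume fG: "(f, G) \<in> opposed_pair A M y w"
  let ?T = "(SIGMA X : Pow (below A f y). Pow X) \<times> (SIGMA X : Pow (above A f y). Pow X)"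
  \<comment> \<open>The larger set of each nested pair comes first: below it belongs to
    \<open>w\<close>, above it to \<open>y\<close>.\<close>
  let ?e = "\<lambda>((X', X), (Y, Y')). X \<times> {y} \<union> X' \<times> {w} \<union> {y} \<times> Y \<union> {w} \<times> Y'"
  let ?E = "?e ` ?T"
  have "finite ?T" using finite_above[OF assms(1)] finite_below[OF assms(1)]
    by (intro finite_cartesian_product finite_SigmaI) (auto intro: finite_subset)
  have "card ?E \<le> card ?T" using \<open>finite ?T\<close> by (rule card_image_le)
  also have "\<dots> = 3 ^ card (below A f y) * 3 ^ card (above A f y)"
    by (simp only: card_cartesian_product card_nested_pairs finite_above finite_below assms(1))
  also have "\<dots> = 3 ^ (card (above A f y) + card (below A f y))"
    by (simp add: power_add)
  also have "\<dots> \<le> 3 ^ (3 * card A div 5)"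
    using fG by (intro power_increasing) (auto simp: opposed_pair_def)
  finally have "card ?E \<le> 3 ^ (3 * card A div 5)" .
  moreover have "H - (A - {y, w}) \<times> (A - {y, w}) \<in> ?E" if "(f, H) \<in> opposed_pair A M y w" for H
  proof -
    have L: "(f, H) \<in> layered A M" and H: "H\<inverse> `` {y} \<subseteq> H\<inverse> `` {w}" "H `` {w} \<subseteq> H `` {y}" "f y = f w"
      using that unfolding opposed_pair_def by auto
    have "H\<inverse> `` {w} \<subseteq> below A f y" using layered_edges_at(2)[OF L, of w] H(3) by (simp add: below_def)
    then have T: "((H\<inverse> `` {w}, H\<inverse> `` {y}), (H `` {y}, H `` {w})) \<in> ?T"
      using H layered_edges_at(3)[OF L, of y] by blast
    have "H - (A - {y, w}) \<times> (A - {y, w}) = ?e ((H\<inverse> `` {w}, H\<inverse> `` {y}), (H `` {y}, H `` {w}))"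
      using layeredD(2)[OF L] by auto
    then show ?thesis using T by (rule image_eqI)
  qed
  ultimately show "\<exists>E. finite E \<and> card E \<le> 3 ^ (3 * card A div 5) \<and>
      (\<forall>H. (f, H) \<in> opposed_pair A M y w \<longrightarrow> H - (A - {y, w}) \<times> (A - {y, w}) \<in> E)"
    using \<open>finite ?T\<close> by (intro exI[of _ ?E]) blast
qed (use assms in \<open>auto simp: opposed_pair_def\<close>)

section \<open>The deletion recursion\<close>

text \<open>These are the graphs to be shown negligible; those left out are bipartite graphs placed
  on two consecutive levels.\<close>

definition spread :: "'a set \<Rightarrow> nat \<Rightarrow> (('a \<Rightarrow> nat) \<times> 'a rel) set" where
  "spread A M = {(f, G) \<in> layered A M. \<not> (\<exists>p. f ` A \<subseteq> {p, p + 1})}"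

text \<open>Once the lower level \<open>p\<close> is chosen, the set of vertices on it and the edges
  determine \<open>(f, G)\<close> and form a bipartite graph.\<close>

lemma card_two_levels:
  assumes "finite A"
  shows "card (layered A M - spread A M) \<le> (M + 1) * bip_count (card A)"
proof -
  define T :: "nat \<Rightarrow> (('a \<Rightarrow> nat) \<times> 'a rel) set" where "T p = {(f, G) \<in> layered A M. f ` A \<subseteq> {p, p + 1}}" for p
  have TD: "(f, G) \<in> layered A M" "f ` A \<subseteq> {p, p + 1}" if "(f, G) \<in> T p" for f G p
    using that unfolding T_def by simp_all
  have "layered A M - spread A M \<subseteq> (\<Union>p\<in>{..M}. T p)"
  proof clarify
    fix f G assume L: "(f, G) \<in> layered A M" and "(f, G) \<notin> spread A M"
    then obtain p where p: "f ` A \<subseteq> {p, p + 1}" unfolding spread_def by blast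
    show "(f, G) \<in> (\<Union>p\<in>{..M}. T p)"
    \<comment> \<open>Without vertices every \<open>p\<close> fits and 0 is taken; otherwise any
      vertex \<open>a\<close> gives \<open>p \<le> f a \<le> M\<close>.\<close>
    proof (cases "A = {}")
      case True
      then show ?thesis using L by (intro UN_I[of 0]) (auto simp: T_def)
    next
      case False
      then obtain a where "a \<in> A" by blast
      moreover have "f a \<le> M" using layeredD(1)[OF L] \<open>a \<in> A\<close> by auto
      ultimately have "p \<le> M" using p by auto
      then show ?thesis using L p by (intro UN_I[of p]) (auto simp: T_def)
    qed
  qed
  moreover have finT: "finite (T p)" for p
    using finite_layered[OF assms] unfolding T_def by (rule finite_subset[rotated]) auto
  ultimately have "card (layered A M - spread A M) \<le> card (\<Union>p\<in>{..M}. T p)"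
    by (intro card_mono) auto
  also have "\<dots> \<le> (\<Sum>p\<in>{..M}. card (T p))" by (rule card_UN_le) simp
  also have "\<dots> \<le> (\<Sum>p\<in>{..M}. bip_count (card A))"
  proof (rule sum_mono)
    fix p :: nat
    let ?g = "\<lambda>(f, G). ({a \<in> A. f a = p}, G)"
    have "inj_on ?g (T p)"
    proof (rule inj_onI, clarify)
      fix f G f' G' assume f: "(f, G) \<in> T p" "(f', G') \<in> T p" and eq: "{a \<in> A. f a = p} = {a \<in> A. f' a = p}"
      have E: "f \<in> A \<rightarrow>\<^sub>E {..M}" "f' \<in> A \<rightarrow>\<^sub>E {..M}"
        using f[THEN TD(1)] layeredD(1) by blast+
      have "f x = f' x" for x
      proof (cases "x \<in> A")
        case True
        then have "f x \<in> {p, p + 1}" "f' x \<in> {p, p + 1}" using f[THEN TD(2)] by blast+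
        moreover have "f x = p \<longleftrightarrow> f' x = p" using eq True by auto
        ultimately show ?thesis by auto
      next
        case False
        then show ?thesis using PiE_arb[OF E(1)] PiE_arb[OF E(2)] by simp
      qed
      then show "f = f' \<and> G = G" by auto
    qed
    moreover have "?g ` T p \<subseteq> bip_graphs A"
    proof clarify
      fix f G assume f: "(f, G) \<in> T p"
      then have L: "(f, G) \<in> layered A M" and p: "f ` A \<subseteq> {p, p + 1}" using TD[OF f] by simp_all
      have "G \<subseteq> {a \<in> A. f a = p} \<times> (A - {a \<in> A. f a = p})"
      proof (rule subrelI)
        fix a b assume "(a, b) \<in> G"
        then have "a \<in> A" "b \<in> A" "f b = f a + 1" using layeredD(2)[OF L] by blast+
        moreover from this have "f a \<in> {p, p + 1}" "f b \<in> {p, p + 1}" using p by blast+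
        ultimately show "(a, b) \<in> {a \<in> A. f a = p} \<times> (A - {a \<in> A. f a = p})" by auto
      qed
      then show "({a \<in> A. f a = p}, G) \<in> bip_graphs A" by (auto simp: bip_graphs_def)
    qed
    ultimately have "card (T p) \<le> card (bip_graphs A)"
      using finite_bip_graphs[OF assms] by (rule card_inj_on_le)
    then show "card (T p) \<le> bip_count (card A)" by (simp add: card_bip_graphs assms)
  qed
  finally show ?thesis by simp
qed

text \<open>If \<open>U y = U w\<close>, then \<open>y'\<close> or \<open>w'\<close> differs from
  both in \<open>U\<close>, and it differs from at least one of them in \<open>D\<close>; otherwise
  \<open>y\<close> and \<open>w\<close> serve.\<close>

lemma pair_separated_by_both:
  assumes "y \<in> S" "w \<in> S" "D y \<noteq> D w" "y' \<in> S" "w' \<in> S" "U y' \<noteq> U w'"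
  shows "\<exists>a\<in>S. \<exists>b\<in>S. D a \<noteq> D b \<and> U a \<noteq> U b"
  using assms by metis

text \<open>Look at the three lowest levels \<open>p\<close>, \<open>p + 1\<close>, \<open>p + 2\<close>. If no vertex has low degree, level \<open>p + 1\<close> has
  more than \<open>2n/5\<close> elements, and so do levels \<open>p\<close> and \<open>p + 2\<close> together. If neither the lower nor the
  upper neighbourhoods are constant on level \<open>p + 1\<close>, some pair there differs in both, and
  \<open>(3+1)\<close>-avoidance forces the two inclusions to be opposite.\<close>

lemma spread_cases:
  assumes "finite A" "(f, G) \<in> spread A M"
  obtains v where "v \<in> A" "(f, G) \<in> low_degree A M v \<union> bottom_uniform A M v \<union> top_uniform A M v"
  | y w where "y \<in> A" "w \<in> A" "y \<noteq> w" "(f, G) \<in> opposed_pair A M y w"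
proof (rule ccontr)
  assume "\<not> thesis"
  note * = that
  have L: "(f, G) \<in> layered A M" and wide: "\<And>p. \<not> f ` A \<subseteq> {p, p + 1}"
    using assms(2) unfolding spread_def by auto
  have big: "2 * card A < 5 * (card (above A f v) + card (below A f v))" if "v \<in> A" for v
    using *(1)[OF that] \<open>\<not> thesis\<close> L unfolding low_degree_def by fastforce
  have "A \<noteq> {}" using wide by blast
  define p where "p = Min (f ` A)"
  define lev where "lev j = {a \<in> A. f a = j}" for j
  define R where "R = {a \<in> A. f a \<ge> p + 3}"
  have "p \<in> f ` A" unfolding p_def using assms(1) \<open>A \<noteq> {}\<close> by (intro Min_in) auto
  then obtain v where v: "v \<in> A" "f v = p" by auto
  have p_le: "p \<le> f a" if "a \<in> A" for a
    unfolding p_def using assms(1) that by (intro Min_le) auto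
  have fin: "finite (lev j)" "finite R" for j unfolding lev_def R_def using assms(1) by auto
  have "below A f v = {}" unfolding below_def using p_le v by fastforce
  have "above A f v = lev (p + 1)" unfolding above_def lev_def v(2) by simp
  then have s: "2 * card A < 5 * card (lev (p + 1))"
    using big[OF v(1)] \<open>below A f v = {}\<close> by simp
  then obtain y0 where y0: "y0 \<in> lev (p + 1)" by (metis card.empty equals0I mult_0_right not_less0)
  have adj: "above A f y = lev (p + 2) \<and> below A f y = lev p" if "y \<in> lev (p + 1)" for y
    using that unfolding above_def below_def lev_def by auto
  have t: "2 * card A < 5 * (card (lev (p + 2)) + card (lev p))"
    using big[of y0] adj[OF y0] y0 unfolding lev_def by auto
  have "A = (lev p \<union> lev (p + 1)) \<union> (lev (p + 2) \<union> R)"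
    using p_le unfolding lev_def R_def by force
  moreover have "card ((lev p \<union> lev (p + 1)) \<union> (lev (p + 2) \<union> R)) =
      (card (lev p) + card (lev (p + 1))) + (card (lev (p + 2)) + card R)"
    using fin by (subst card_Un_disjoint; auto simp: lev_def R_def card_Un_disjoint)+
  ultimately have "card A = card (lev p) + card (lev (p + 1)) + card (lev (p + 2)) + card R" by simp
  then have n: "5 * card A = 5 * card (lev (p + 1)) + 5 * (card (lev (p + 2)) + card (lev p)) + 5 * card R"
    by simp
  \<comment> \<open>Two disjoint parts with more than 2n/5 vertices each leave less than n/5 for the
    levels above \<open>p + 2\<close>.\<close>
  then have r: "5 * card R \<le> card A" using s t by linarith
  \<comment> \<open>Otherwise a vertex of top rank, which is at least \<open>p + 3\<close>, has all
    its possible neighbours in \<open>R\<close> and hence low degree.\<close>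
  have "lev (p + 2) \<noteq> {}"
  proof
    assume none: "lev (p + 2) = {}"
    define q where "q = Max (f ` A)"
    have "q \<in> f ` A" unfolding q_def using assms(1) \<open>A \<noteq> {}\<close> by (intro Max_in) auto
    then obtain x where x: "x \<in> A" "f x = q" by auto
    have q_ge: "f a \<le> q" if "a \<in> A" for a
      unfolding q_def using assms(1) that by (intro Max_ge) auto
    obtain a where a: "a \<in> A" "f a \<notin> {p, p + 1}" using wide[of p] by auto
    then have "f a \<ge> p + 3" using p_le[OF a(1)] none unfolding lev_def by fastforce
    then have "q \<ge> p + 3" using q_ge[OF a(1)] by simp
    have "above A f x = {}" unfolding above_def using q_ge x by fastforce
    moreover have "below A f x \<subseteq> R"
      unfolding below_def R_def using none x(2) \<open>q \<ge> p + 3\<close> unfolding lev_def by force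
    then have "card (below A f x) \<le> card R" using fin by (intro card_mono)
    ultimately have "2 * card A < 5 * card R" using big[OF x(1)] by simp
    then show False using r by linarith
  qed
  then obtain z where z: "z \<in> lev (p + 2)" by blast
  \<comment> \<open>Since nothing lies below \<open>v\<close>, this gives two vertices on level
    \<open>p + 1\<close> with different lower neighbourhoods; \<open>z\<close> will likewise give
    two with different upper ones.\<close>
  have "(f, G) \<notin> bottom_uniform A M v"
    using *(1)[OF v(1)] \<open>\<not> thesis\<close> by blast
  then obtain y w where yw: "y \<in> lev (p + 1)" "w \<in> lev (p + 1)" "G\<inverse> `` {y} \<noteq> G\<inverse> `` {w}"
    using L \<open>below A f v = {}\<close> \<open>above A f v = lev (p + 1)\<close> unfolding bottom_uniform_def by blast
  have "z \<in> A" "below A f z = lev (p + 1)" "above A f z \<subseteq> R"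
    using z unfolding below_def above_def lev_def R_def by auto
  moreover have "card (above A f z) \<le> card R" using fin \<open>above A f z \<subseteq> R\<close> by (intro card_mono)
  then have "5 * card (above A f z) \<le> card A" using r by linarith
  moreover have "(f, G) \<notin> top_uniform A M z"
    using *(1)[OF \<open>z \<in> A\<close>] \<open>\<not> thesis\<close> by blast
  ultimately obtain y' w' where "y' \<in> lev (p + 1)" "w' \<in> lev (p + 1)" "G `` {y'} \<noteq> G `` {w'}"
    using L unfolding top_uniform_def by blast
  then obtain a b where ab: "a \<in> lev (p + 1)" "b \<in> lev (p + 1)"
    "G\<inverse> `` {a} \<noteq> G\<inverse> `` {b}" "G `` {a} \<noteq> G `` {b}"
    using pair_separated_by_both[OF yw(1,2), of "\<lambda>y. G\<inverse> `` {y}" y' w' "\<lambda>y. G `` {y}"] yw(3) by blast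
  then have "a \<in> A" "b \<in> A" "f a = f b" "a \<noteq> b" unfolding lev_def by auto
  \<comment> \<open>Level \<open>p + 1\<close> already takes more than 2n/5 of the vertices.\<close>
  have "5 * (card (lev (p + 2)) + card (lev p)) \<le> 3 * card A" using s n by linarith
  then have few: "5 * (card (above A f x) + card (below A f x)) \<le> 3 * card A" if "x \<in> lev (p + 1)" for x
    using adj[OF that] by simp
  have "G\<inverse> `` {a} \<subseteq> G\<inverse> `` {b} \<or> G `` {a} \<subseteq> G `` {b}" "G\<inverse> `` {b} \<subseteq> G\<inverse> `` {a} \<or> G `` {b} \<subseteq> G `` {a}"
    using layeredD(3)[OF L] \<open>a \<in> A\<close> \<open>b \<in> A\<close> \<open>f a = f b\<close> by simp_all
  \<comment> \<open>As \<open>a\<close> and \<open>b\<close> differ in both neighbourhoods, the two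
    disjunctions cannot both hold through the same kind of neighbourhood.\<close>
  then consider "G\<inverse> `` {a} \<subseteq> G\<inverse> `` {b}" "G `` {b} \<subseteq> G `` {a}"
    | "G\<inverse> `` {b} \<subseteq> G\<inverse> `` {a}" "G `` {a} \<subseteq> G `` {b}"
    using ab(3,4) by blast
  then have "(f, G) \<in> opposed_pair A M a b \<or> (f, G) \<in> opposed_pair A M b a"
    using L few[OF ab(1)] few[OF ab(2)] \<open>f a = f b\<close> by cases (simp_all add: opposed_pair_def)
  then show False
    using *(2)[of a b] *(2)[of b a] \<open>a \<in> A\<close> \<open>b \<in> A\<close> \<open>a \<noteq> b\<close> \<open>\<not> thesis\<close> by blast
qed

text \<open>Union bound over the single vertices and the ordered pairs supplied by
  \<open>spread_cases\<close>.\<close>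

lemma card_spread_recursion:
  fixes A :: "'a set" and n M K L :: nat
  assumes "finite A" "card A = n"
    and K: "\<And>v. v \<in> A \<Longrightarrow> card (layered (A - {v}) M) \<le> K"
    and L: "\<And>y w. \<lbrakk>y \<in> A; w \<in> A; y \<noteq> w\<rbrakk> \<Longrightarrow> card (layered (A - {y, w}) M) \<le> L"
  shows "card (spread A M) \<le> n * ((2 ^ (2 * n div 5) + 2 + 2 * 2 ^ (n div 5)) * ((M + 1) * K))
           + n * n * (3 ^ (3 * n div 5) * ((M + 1) * L))"
proof -
  define S1 where "S1 v = low_degree A M v \<union> bottom_uniform A M v \<union> top_uniform A M v" for v
  define S2 where "S2 = (\<lambda>(y, w). opposed_pair A M y w)"
  define Q where "Q = A \<times> A - Id"
  have "finite Q" using assms(1) by (simp add: Q_def)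
  have finL: "finite (layered A M)" by (rule finite_layered[OF assms(1)])
  have "S1 v \<subseteq> layered A M" "S2 q \<subseteq> layered A M" for v q
    unfolding S1_def S2_def low_degree_def bottom_uniform_def top_uniform_def opposed_pair_def by auto
  then have fin: "finite (\<Union>v\<in>A. S1 v)" "finite (\<Union>q\<in>Q. S2 q)"
    using finL assms(1) \<open>finite Q\<close> by (meson finite_UN_I finite_subset)+
  have S1: "card (S1 v) \<le> (2 ^ (2 * n div 5) + 2 + 2 * 2 ^ (n div 5)) * ((M + 1) * K)" if "v \<in> A" for v
  proof -
    define k where "k = (M + 1) * card (layered (A - {v}) M)"
    have "card (S1 v) \<le> card (low_degree A M v) + card (bottom_uniform A M v) + card (top_uniform A M v)"
      unfolding S1_def by (meson add_mono card_Un_le le_refl le_trans)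
    also have "\<dots> \<le> 2 ^ (2 * n div 5) * k + 2 * k + 2 * 2 ^ (n div 5) * k"
      unfolding k_def using card_low_degree[OF assms(1) that, of M] card_bottom_uniform[OF assms(1) that, of M]
        card_top_uniform[OF assms(1) that, of M] unfolding assms(2) by (intro add_mono)
    also have "\<dots> = (2 ^ (2 * n div 5) + 2 + 2 * 2 ^ (n div 5)) * k"
      by (simp add: algebra_simps)
    also have "\<dots> \<le> (2 ^ (2 * n div 5) + 2 + 2 * 2 ^ (n div 5)) * ((M + 1) * K)"
      unfolding k_def using K[OF that] by (intro mult_mono) auto
    finally show ?thesis .
  qed
  have S2: "card (S2 q) \<le> 3 ^ (3 * n div 5) * ((M + 1) * L)" if qQ: "q \<in> Q" for q
  proof -
    obtain y w where q: "q = (y, w)" "y \<in> A" "w \<in> A" "y \<noteq> w" using qQ unfolding Q_def by auto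
    have "card (S2 q) \<le> 3 ^ (3 * n div 5) * ((M + 1) * card (layered (A - {y, w}) M))"
      unfolding S2_def q(1) using card_opposed_pair[OF assms(1) q(2,3), of M] unfolding assms(2) by simp
    also have "\<dots> \<le> 3 ^ (3 * n div 5) * ((M + 1) * L)"
      using L[OF q(2,3,4)] by (intro mult_mono) auto
    finally show ?thesis .
  qed
  have "spread A M \<subseteq> (\<Union>v\<in>A. S1 v) \<union> (\<Union>q\<in>Q. S2 q)"
  proof
    fix x assume "x \<in> spread A M"
    then obtain f G where x: "x = (f, G)" "(f, G) \<in> spread A M" by (cases x) auto
    from assms(1) x(2) show "x \<in> (\<Union>v\<in>A. S1 v) \<union> (\<Union>q\<in>Q. S2 q)"
    proof (cases rule: spread_cases)
      case (1 v)
      then show ?thesis unfolding S1_def x(1) by blast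
    next
      case (2 y w)
      then have "(y, w) \<in> Q" "x \<in> S2 (y, w)" by (simp_all add: Q_def S2_def x(1))
      then show ?thesis by blast
    qed
  qed
  then have "card (spread A M) \<le> card ((\<Union>v\<in>A. S1 v) \<union> (\<Union>q\<in>Q. S2 q))"
    using fin by (intro card_mono) auto
  also have "\<dots> \<le> card (\<Union>v\<in>A. S1 v) + card (\<Union>q\<in>Q. S2 q)"
    by (rule card_Un_le)
  also have "\<dots> \<le> (\<Sum>v\<in>A. card (S1 v)) + (\<Sum>q\<in>Q. card (S2 q))"
    using assms(1) \<open>finite Q\<close> by (intro add_mono card_UN_le)
  also have "\<dots> \<le> card A * ((2 ^ (2 * n div 5) + 2 + 2 * 2 ^ (n div 5)) * ((M + 1) * K))
      + card Q * (3 ^ (3 * n div 5) * ((M + 1) * L))"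
    using sum_bounded_above[of A, OF S1] sum_bounded_above[of Q, OF S2] by (intro add_mono) auto
  also have "\<dots> \<le> n * ((2 ^ (2 * n div 5) + 2 + 2 * 2 ^ (n div 5)) * ((M + 1) * K))
      + (n * n) * (3 ^ (3 * n div 5) * ((M + 1) * L))"
  proof -
    have "card Q \<le> card (A \<times> A)" using assms(1) by (intro card_mono) (auto simp: Q_def)
    then have "card Q \<le> n * n" by (simp only: card_cartesian_product assms(2))
    then show ?thesis unfolding assms(2) by (intro add_left_mono mult_right_mono) auto
  qed
  finally show ?thesis .
qed

section \<open>Layered graphs on more than two levels are negligible\<close>

text \<open>The constant 7 = 5 + 2 collects vertex and pair deletions; the exponent is 24n/25 - n
  from pairs, weaker than 2n/5 - n/2 from single vertices.\<close>

definition removal_error :: "nat \<Rightarrow> nat \<Rightarrow> real" where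
  "removal_error M n = 7 * real n ^ 2 * (real M + 1) * 2 powr (- real n / 25)"

section \<open>Numerical estimates for the recursion\<close>

lemma sqrt2_power: "sqrt 2 ^ n = 2 powr (real n / 2)"
  by (simp add: powr_half_sqrt[symmetric] powr_realpow[symmetric] powr_powr)

lemma bip_count_pred:
  assumes "n \<ge> 1"
  shows "real (bip_count (n - 1)) \<le> real (bip_count n) * 2 powr (- real n / 2)"
proof -
  have "2 powr (real n / 2) * real (bip_count (n - 1)) \<le> real (bip_count n)"
    using bip_count_growth[of "n - 1"] assms by (simp add: sqrt2_power[symmetric])
  then show ?thesis by (simp add: powr_minus field_simps)
qed

lemma bip_count_pred2:
  assumes "n \<ge> 2"
  shows "real (bip_count (n - 2)) \<le> real (bip_count n) * (2 * 2 powr (- real n))"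
proof -
  have "real (bip_count (n - 2)) \<le> real (bip_count (n - 1)) * 2 powr (- real (n - 1) / 2)"
    using bip_count_pred[of "n - 1"] assms by (simp add: diff_diff_eq numeral_2_eq_2)
  also have "\<dots> \<le> (real (bip_count n) * 2 powr (- real n / 2)) * 2 powr (- real (n - 1) / 2)"
    using assms by (intro mult_right_mono bip_count_pred) auto
  also have "\<dots> = real (bip_count n) * 2 powr (- real n + 1 / 2)"
  proof -
    have "- real n / 2 + - real (n - 1) / 2 = - real n + 1 / 2"
      using assms by (simp add: of_nat_diff field_simps)
    then show ?thesis by (simp only: mult.assoc powr_add[symmetric])
  qed
  also have "\<dots> \<le> real (bip_count n) * 2 powr (- real n + 1)"
    by (intro mult_left_mono powr_mono) auto
  also have "\<dots> = real (bip_count n) * (2 * 2 powr (- real n))"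
    using powr_add[of 2 "- real n" 1] by simp
  finally show ?thesis .
qed

text \<open>Comes from \<open>3 ^ 15 \<le> 2 ^ 24\<close>. The exponent has to stay below
  \<open>n\<close> by a constant factor, since deleting two vertices gains a factor of order
  \<open>2 ^ n\<close> by \<open>bip_count_pred2\<close>.\<close>

lemma three_power_le: "3 ^ (3 * n div 5) \<le> (2::real) powr (24 * real n / 25)"
proof -
  define m where "m = 3 * n div 5"
  have "real (5 * m) \<le> real (3 * n)" unfolding m_def by (subst of_nat_le_iff) simp
  have "(3::real) ^ m = (3 ^ 15) powr (real m / 15)"
    by (simp add: powr_powr powr_realpow[symmetric] del: powr_numeral)
  also have "\<dots> \<le> (2 ^ 24) powr (real m / 15)" by (intro powr_mono2) auto
  also have "\<dots> = 2 powr (24 * (real m / 15))"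
  proof -
    have p: "(2::real) ^ 24 = 2 powr real 24" by (rule powr_realpow[symmetric]) simp
    show ?thesis unfolding p powr_powr by simp
  qed
  also have "\<dots> \<le> 2 powr (24 * real n / 25)"
    using \<open>real (5 * m) \<le> real (3 * n)\<close> by (intro powr_mono) auto
  finally show ?thesis unfolding m_def .
qed

lemma two_power_div_le: "2 ^ (k * n div 5) \<le> (2::real) powr (real k * real n / 5)"
proof -
  have "real (k * n div 5) \<le> real k * real n / 5"
    using real_of_nat_div[of "k * n" 5] of_nat_div_le_of_nat[of "k * n" 5] by simp
  then show ?thesis by (simp add: powr_realpow[symmetric])
qed

lemma card_spread_le:
  assumes "finite A" "card A = n" "n \<ge> 2" "C \<ge> 0"
    and smaller: "\<And>B. B \<subset> A \<Longrightarrow> real (card (layered B M)) \<le> C * real (bip_count (card B))"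
  shows "real (card (spread A M)) \<le> removal_error M n * (C * real (bip_count n))"
proof -
  \<comment> \<open>Rounded down because the recursion takes natural numbers as bounds.\<close>
  define K L where "K = nat \<lfloor>C * real (bip_count (n - 1))\<rfloor>" and "L = nat \<lfloor>C * real (bip_count (n - 2))\<rfloor>"
  define b where "b = real (bip_count n)"
  define x where "x = (2::real) powr (- real n / 25)"
  have "b \<ge> 0" "x \<ge> 0" by (simp_all add: b_def x_def)
  have "card (layered (A - {v}) M) \<le> K" if "v \<in> A" for v
  proof -
    have "A - {v} \<subset> A" "card (A - {v}) = n - 1" using that assms(1,2) by auto
    then have "real (card (layered (A - {v}) M)) \<le> C * real (bip_count (n - 1))"
      using smaller[of "A - {v}"] by simp
    then show ?thesis unfolding K_def by (rule le_nat_floor)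
  qed
  moreover have "card (layered (A - {y, w}) M) \<le> L" if "y \<in> A" "w \<in> A" "y \<noteq> w" for y w
  proof -
    have "A - {y, w} \<subset> A" "card (A - {y, w}) = n - 2"
      using that assms(1,2) by (auto simp: card_Diff_subset)
    then have "real (card (layered (A - {y, w}) M)) \<le> C * real (bip_count (n - 2))"
      using smaller[of "A - {y, w}"] by simp
    then show ?thesis unfolding L_def by (rule le_nat_floor)
  qed
  ultimately have rec: "card (spread A M) \<le> n * ((2 ^ (2 * n div 5) + 2 + 2 * 2 ^ (n div 5)) * ((M + 1) * K))
      + n * n * (3 ^ (3 * n div 5) * ((M + 1) * L))"
    by (rule card_spread_recursion[OF assms(1,2)])
  have K: "real K \<le> C * (b * 2 powr (- real n / 2))"
  proof -
    have "real K \<le> C * real (bip_count (n - 1))" unfolding K_def using assms(4) by (simp add: of_nat_floor)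
    also have "\<dots> \<le> C * (b * 2 powr (- real n / 2))"
      unfolding b_def using bip_count_pred[of n] assms(3,4) by (intro mult_left_mono) auto
    finally show ?thesis .
  qed
  have L: "real L \<le> C * (b * (2 * 2 powr (- real n)))"
  proof -
    have "real L \<le> C * real (bip_count (n - 2))" unfolding L_def using assms(4) by (simp add: of_nat_floor)
    also have "\<dots> \<le> C * (b * (2 * 2 powr (- real n)))"
      unfolding b_def using bip_count_pred2[of n] assms(3,4) by (intro mult_left_mono) auto
    finally show ?thesis .
  qed
  define y where "y = (2::real) powr (2 * real n / 5)"
  have "1 \<le> y" unfolding y_def by (intro ge_one_powr_ge_zero) auto
  moreover have "(2::real) ^ (n div 5) \<le> y"
  proof -
    have "(2::real) powr (real n / 5) \<le> y" unfolding y_def by (intro powr_mono) auto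
    then show ?thesis using two_power_div_le[of 1 n] by simp
  qed
  moreover have "(2::real) ^ (2 * n div 5) \<le> y"
    using two_power_div_le[of 2 n] by (simp add: y_def)
  \<comment> \<open>The three terms are at most \<open>y\<close>, \<open>2 * y\<close> and
    \<open>2 * y\<close>.\<close>
  ultimately have "2 ^ (2 * n div 5) + 2 + 2 * 2 ^ (n div 5) \<le> 5 * y" by linarith
  then have "(2 ^ (2 * n div 5) + 2 + 2 * 2 ^ (n div 5)) * real K \<le> (5 * y) * (C * (b * 2 powr (- real n / 2)))"
    using K \<open>1 \<le> y\<close> by (intro mult_mono) auto
  \<comment> \<open>The exponent is 2n/5 - n/2; it is then weakened to match that of the pair
    term.\<close>
  also have "\<dots> = 5 * C * b * 2 powr (- real n / 10)"
    by (simp add: y_def powr_add[symmetric] field_simps)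
  also have "\<dots> \<le> 5 * C * b * x"
    unfolding x_def using assms(4) \<open>b \<ge> 0\<close> by (intro mult_left_mono powr_mono) auto
  finally have 1: "(2 ^ (2 * n div 5) + 2 + 2 * 2 ^ (n div 5)) * real K \<le> 5 * C * b * x" .
  have "3 ^ (3 * n div 5) * real L \<le> 2 powr (24 * real n / 25) * (C * (b * (2 * 2 powr (- real n))))"
    using three_power_le L by (intro mult_mono) auto
  also have "\<dots> = 2 * C * b * x"
    by (simp add: x_def powr_add[symmetric] field_simps)
  finally have 2: "3 ^ (3 * n div 5) * real L \<le> 2 * C * b * x" .
  have "real (card (spread A M)) \<le> real (n * ((2 ^ (2 * n div 5) + 2 + 2 * 2 ^ (n div 5)) * ((M + 1) * K))
      + n * n * (3 ^ (3 * n div 5) * ((M + 1) * L)))"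
    using rec by (subst of_nat_le_iff)
  also have "\<dots> = real n * (real M + 1) * ((2 ^ (2 * n div 5) + 2 + 2 * 2 ^ (n div 5)) * real K)
      + real n ^ 2 * (real M + 1) * (3 ^ (3 * n div 5) * real L)"
    by (simp add: power2_eq_square algebra_simps)
  also have "\<dots> \<le> real n ^ 2 * (real M + 1) * (5 * C * b * x) + real n ^ 2 * (real M + 1) * (2 * C * b * x)"
  proof (intro add_mono)
    have "real n \<le> real n ^ 2" using assms(3) by (simp add: power2_eq_square)
    then show "real n * (real M + 1) * ((2 ^ (2 * n div 5) + 2 + 2 * 2 ^ (n div 5)) * real K)
        \<le> real n ^ 2 * (real M + 1) * (5 * C * b * x)"
      by (intro mult_mono[OF _ 1]) auto
    show "real n ^ 2 * (real M + 1) * (3 ^ (3 * n div 5) * real L)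
        \<le> real n ^ 2 * (real M + 1) * (2 * C * b * x)"
      by (intro mult_left_mono[OF 2]) auto
  qed
  also have "\<dots> = removal_error M n * (C * real (bip_count n))"
    by (simp add: removal_error_def x_def b_def algebra_simps)
  finally show ?thesis .
qed

text \<open>Induction over subsets. Below size \<open>K\<close> the constant absorbs the trivial
  bound; from there on \<open>spread\<close> takes at most half of the claimed bound, and the graphs
  on two levels fit into the other half.\<close>

lemma card_layered_le:
  assumes "2 \<le> K" and err: "\<And>k. \<lbrakk>K \<le> k; k \<le> N\<rbrakk> \<Longrightarrow> removal_error M k \<le> 1 / 2"
    and "finite A" "card A \<le> N"
  shows "real (card (layered A M)) \<le> 2 * (real M + 1) * ((real M + 1) ^ K * 2 ^ K\<^sup>2) * real (bip_count (card A))"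
  using assms(3,4)
proof (induction A rule: finite_psubset_induct)
  case (psubset A)
  define X where "X = (real M + 1) ^ K * 2 ^ K\<^sup>2"
  define b where "b = real (bip_count (card A))"
  have "b \<ge> 1" using bip_count_pos[of "card A"] by (simp add: b_def)
  have "X \<ge> 1 * 1" unfolding X_def by (intro mult_mono) auto
  then have "X \<ge> 1" by simp
  have "real (card (layered A M)) \<le> 2 * (real M + 1) * X * b"
  proof (cases "card A < K")
    case True
    have "real (card (layered A M)) \<le> real ((M + 1) ^ card A * 2 ^ (card A ^ 2))"
      using card_layered_trivial[OF psubset(1)] by (subst of_nat_le_iff)
    also have "\<dots> = (real M + 1) ^ card A * 2 ^ (card A ^ 2)" by (simp add: add.commute)
    also have "\<dots> \<le> X"
      unfolding X_def using True by (intro mult_mono power_increasing power_mono) auto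
    also have "\<dots> \<le> (2 * (real M + 1) * b) * X"
    proof -
      have "1 * 1 \<le> (2 * (real M + 1)) * b" using \<open>b \<ge> 1\<close> by (intro mult_mono) auto
      then show ?thesis using \<open>X \<ge> 1\<close> mult_right_mono[of 1 "2 * (real M + 1) * b" X] by simp
    qed
    finally show ?thesis by (simp add: algebra_simps)
  next
    case False
    have "real (card (layered B M)) \<le> (2 * (real M + 1) * X) * real (bip_count (card B))" if "B \<subset> A" for B
    proof -
      have "card B \<le> N" using psubset_card_mono[OF psubset(1) that] psubset.prems by linarith
      from psubset.IH[OF that this] show ?thesis unfolding X_def .
    qed
    then have "real (card (spread A M)) \<le> removal_error M (card A) * ((2 * (real M + 1) * X) * b)"
      unfolding b_def using False assms(1) \<open>X \<ge> 1\<close>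
      by (intro card_spread_le[OF psubset(1)]) auto
    also have "\<dots> \<le> 1 / 2 * ((2 * (real M + 1) * X) * b)"
      using err[of "card A"] False psubset.prems \<open>X \<ge> 1\<close> \<open>b \<ge> 1\<close> by (intro mult_right_mono) auto
    finally have 1: "real (card (spread A M)) \<le> (real M + 1) * X * b"
      by (simp add: algebra_simps)
    have "real (card (layered A M - spread A M)) \<le> real ((M + 1) * bip_count (card A))"
      using card_two_levels[OF psubset(1)] by (subst of_nat_le_iff)
    also have "\<dots> = (real M + 1) * 1 * b" by (simp add: b_def algebra_simps)
    also have "\<dots> \<le> (real M + 1) * X * b"
      using \<open>X \<ge> 1\<close> \<open>b \<ge> 1\<close> by (intro mult_mono) auto
    finally have 2: "real (card (layered A M - spread A M)) \<le> (real M + 1) * X * b" .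
    have "layered A M = spread A M \<union> (layered A M - spread A M)" unfolding spread_def by auto
    then have "card (layered A M) \<le> card (spread A M) + card (layered A M - spread A M)"
      by (metis card_Un_le)
    then have "real (card (layered A M)) \<le> real (card (spread A M) + card (layered A M - spread A M))"
      by (subst of_nat_le_iff)
    then show ?thesis using 1 2 by (simp add: algebra_simps)
  qed
  then show ?case by (simp add: X_def b_def)
qed

text \<open>The threshold \<open>n powr (1/3)\<close> is large enough for the removal error to be small, and small
  enough for the trivial bound below it to be \<open>2 powr o(n)\<close>.\<close>

lemma spread_negligible:
  obtains \<eta> :: "nat \<Rightarrow> real" where "\<eta> \<longlonglongrightarrow> 0"
    and "\<forall>\<^sub>F n in at_top. real (card (spread {1..n} n)) \<le> \<eta> n * real (bip_count n)"
proof
  define t where "t n = real n powr (1 / 3)" for n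
  \<comment> \<open>A real upper bound for the constant of \<open>card_layered_le\<close> with
    \<open>M = n\<close> and \<open>K\<close> the ceiling of \<open>t n\<close>.\<close>
  define Y where "Y n = 2 * (real n + 1) * ((real n + 1) powr (t n + 1) * 2 powr ((t n + 1)\<^sup>2))" for n
  define \<eta> where "\<eta> n = removal_error n n * Y n" for n
  \<comment> \<open>\<open>Y n\<close> is 2 to a power of order n^(2/3), which the exponential
    factor of the removal error outweighs.\<close>
  show "\<eta> \<longlonglongrightarrow> 0"
    unfolding \<eta>_def removal_error_def Y_def t_def by real_asymp
  have "\<forall>\<^sub>F n in at_top. 7 * real n ^ 2 * (real n + 1) * 2 powr (- t n / 25) \<le> 1 / 2"
    unfolding t_def by real_asymp
  moreover have "\<forall>\<^sub>F n in at_top. t n \<ge> 2" unfolding t_def by real_asymp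
  moreover have "\<forall>\<^sub>F n::nat in at_top. n \<ge> 2" by (rule eventually_ge_at_top)
  ultimately show "\<forall>\<^sub>F n in at_top. real (card (spread {1..n} n)) \<le> \<eta> n * real (bip_count n)"
  proof eventually_elim
    case (elim n)
    define K where "K = nat \<lceil>t n\<rceil>"
    have K: "t n \<le> real K" "real K \<le> t n + 1" using elim(2) unfolding K_def by linarith+
    \<comment> \<open>Uniform in \<open>k\<close>: the polynomial factor is bounded by its value at
      \<open>n\<close>, the exponential one by its value at \<open>t n\<close>.\<close>
    have err: "removal_error n k \<le> 1 / 2" if "K \<le> k" "k \<le> n" for k
    proof -
      have "removal_error n k \<le> 7 * real n ^ 2 * (real n + 1) * 2 powr (- t n / 25)"
        unfolding removal_error_def using that K by (intro mult_mono powr_mono power_mono) auto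
      then show ?thesis using elim(1) by linarith
    qed
    have "2 \<le> K" using K(1) elim(2) by linarith
    define Z where "Z = 2 * (real n + 1) * ((real n + 1) ^ K * 2 ^ K\<^sup>2)"
    have "Z \<le> Y n"
    proof -
      have "(real n + 1) ^ K \<le> (real n + 1) powr (t n + 1)"
        using K by (subst powr_realpow[symmetric]) (auto intro: powr_mono)
      moreover have "(2::real) ^ K\<^sup>2 \<le> 2 powr ((t n + 1)\<^sup>2)"
        using K by (subst powr_realpow[symmetric]) (auto intro!: powr_mono power_mono)
      ultimately show ?thesis unfolding Z_def Y_def by (intro mult_left_mono mult_mono) auto
    qed
    have "real (card (layered B n)) \<le> Z * real (bip_count (card B))" if "B \<subset> {1..n}" for B
      unfolding Z_def
    proof (rule card_layered_le[OF \<open>2 \<le> K\<close> err])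
      show "finite B" "card B \<le> n"
        using that finite_subset[of B "{1..n}"] card_mono[of "{1..n}" B] by auto
    qed
    then have "real (card (spread {1..n} n)) \<le> removal_error n n * (Z * real (bip_count n))"
      using elim(3) by (intro card_spread_le) (auto simp: Z_def)
    also have "\<dots> \<le> removal_error n n * (Y n * real (bip_count n))"
      using \<open>Z \<le> Y n\<close> by (intro mult_left_mono mult_right_mono) (auto simp: removal_error_def)
    finally show ?case by (simp add: \<eta>_def algebra_simps)
  qed
qed

section \<open>Posets without a chain of three elements\<close>

definition isolated_in :: "'a rel \<Rightarrow> 'a \<Rightarrow> bool" where
  "isolated_in G v \<longleftrightarrow> v \<notin> Field G"

text \<open>As no vertex is isolated, \<open>S\<close> consists of the minimal elements and
  \<open>A - S\<close> of the maximal ones, so ranks 0 and 1 on these sets grade the poset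
  strongly.\<close>

lemma bip_poset:
  assumes "(S, G) \<in> bip_graphs A" and cover: "A \<subseteq> Field G"
  defines "r \<equiv> Id_on A \<union> G"
  shows "partial_order_on A r" "strongly_graded A r" "avoids_3_plus_1 A r"
proof -
  have S: "S \<subseteq> A" and G: "a \<in> S \<and> b \<in> A \<and> b \<notin> S" if "(a, b) \<in> G" for a b
    using assms(1) that unfolding bip_graphs_def by auto
  have in_r: "(a, b) \<in> r \<longleftrightarrow> a \<in> A \<and> a = b \<or> (a, b) \<in> G" for a b
    unfolding r_def by auto
  show "partial_order_on A r"
    unfolding partial_order_on_def preorder_on_def
  proof (intro conjI)
    show "r \<subseteq> A \<times> A" using assms(1) unfolding bip_graphs_def r_def by auto
    show "refl_on A r" unfolding refl_on_def in_r by blast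
    show "trans r" unfolding trans_def in_r using G by blast
    show "antisym r" unfolding antisym_def in_r using G by blast
  qed
  have sb: "strictly_below r a b \<longleftrightarrow> (a, b) \<in> G" for a b
    using G unfolding strictly_below_def r_def by auto
  show "avoids_3_plus_1 A r"
    unfolding avoids_3_plus_1_def sb using G by blast
  define rk :: "'a \<Rightarrow> nat" where "rk v = (if v \<in> S then 0 else 1)" for v
  have lower: "\<exists>w. (w, v) \<in> G" if "v \<in> A" "v \<notin> S" for v
    using that cover G unfolding Field_def by blast
  have upper: "\<exists>w. (v, w) \<in> G" if "v \<in> A" "v \<in> S" for v
    using that cover G unfolding Field_def by blast
  have "rank_function A r rk"
    unfolding rank_function_def
  proof (intro conjI ballI impI)
    fix a b assume "covers r b a"
    then have "(a, b) \<in> G" using sb unfolding covers_def by blast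
    then show "rk b = rk a + 1" using G unfolding rk_def by auto
  next
    fix C assume "C \<in> poset_components A r"
    then obtain x where x: "x \<in> A" "C = (r \<union> r\<inverse>)\<^sup>* `` {x}"
      unfolding poset_components_def by (auto elim: quotientE)
    \<comment> \<open>A component contains, with each vertex outside \<open>S\<close>, one of its
      lower neighbours, so rank 0 is attained.\<close>
    have "\<exists>s\<in>C. s \<in> S"
    proof (cases "x \<in> S")
      case False
      then obtain w where w: "(w, x) \<in> G" using lower[OF x(1)] by blast
      then have "(x, w) \<in> r \<union> r\<inverse>" unfolding r_def by blast
      then show ?thesis using x(2) G[OF w] by blast
    qed (use x(2) in blast)
    then have "0 \<in> rk ` C" unfolding rk_def by force
    moreover have "finite (rk ` C)" by (rule finite_subset[of _ "{0, 1}"]) (auto simp: rk_def)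
    ultimately show "Min (rk ` C) = 0" by (metis Min_le le_zero_eq)
  qed
  moreover have "rk x = 0" if "x \<in> minimal_elements A r" for x
  proof -
    have "x \<in> A" "\<And>y. y \<in> A \<Longrightarrow> (y, x) \<notin> G" using that unfolding minimal_elements_def sb by blast+
    then have "x \<in> S" using lower[of x] G S by blast
    then show ?thesis by (simp add: rk_def)
  qed
  moreover have "rk x = 1" if "x \<in> maximal_elements A r" for x
  proof -
    have "x \<in> A" "\<And>y. y \<in> A \<Longrightarrow> (x, y) \<notin> G" using that unfolding maximal_elements_def sb by blast+
    then have "x \<notin> S" using upper[of x] G by blast
    then show ?thesis by (simp add: rk_def)
  qed
  ultimately show "strongly_graded A r" unfolding strongly_graded_def by (intro exI[of _ rk]) simp
qed

lemma finite_posets: "finite A \<Longrightarrow> finite {r. partial_order_on A r \<and> P r}"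
  by (rule finite_subset[of _ "Pow (A \<times> A)"])
     (auto simp: partial_order_on_def preorder_on_def refl_on_def)

text \<open>An isolated vertex can be deleted without touching an edge; the factor 2 records its
  side.\<close>

lemma card_bip_isolated:
  assumes "finite A" "card A = n"
  shows "card {(S, G) \<in> bip_graphs A. \<not> A \<subseteq> Field G} \<le> n * (2 * bip_count (n - 1))"
proof -
  define I where "I v = {(S, G) \<in> bip_graphs A. v \<notin> Field G}" for v
  have fin: "finite (\<Union>v\<in>A. I v)"
    using assms(1) finite_bip_graphs[OF assms(1)] unfolding I_def
    by (intro finite_UN_I finite_subset[OF _ finite_bip_graphs[OF assms(1)]]) auto
  have "card (I v) \<le> 2 * bip_count (n - 1)" if v: "v \<in> A" for v
  proof -
    let ?p = "\<lambda>(S, G). (S - {v}, G)"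
    have "card (I v) \<le> 2 * card (bip_graphs (A - {v}))"
    proof (rule card_le_fibres[where \<pi> = ?p])
      show "finite (bip_graphs (A - {v}))" using assms(1) by (simp add: finite_bip_graphs)
      show "?p ` I v \<subseteq> bip_graphs (A - {v})"
        unfolding I_def bip_graphs_def Field_def by fastforce
      fix t :: "'a set \<times> 'a rel"
      obtain S G where t: "t = (S, G)" by (cases t)
      have "{s \<in> I v. ?p s = t} \<subseteq> {(S, G), (insert v S, G)}"
        unfolding t by auto
      then have "card {s \<in> I v. ?p s = t} \<le> card {(S, G), (insert v S, G)}"
        by (intro card_mono) auto
      also have "\<dots> \<le> 2" by (simp add: card_insert_if)
      finally show "card {s \<in> I v. ?p s = t} \<le> 2" .
    qed
    then show ?thesis using assms v by (simp add: card_bip_graphs)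
  qed
  then have "(\<Sum>v\<in>A. card (I v)) \<le> n * (2 * bip_count (n - 1))"
    using sum_bounded_above[of A "\<lambda>v. card (I v)"] assms(2) by auto
  moreover have "card (\<Union>v\<in>A. I v) \<le> (\<Sum>v\<in>A. card (I v))"
    using assms(1) by (rule card_UN_le)
  moreover have "card {(S, G) \<in> bip_graphs A. \<not> A \<subseteq> Field G} \<le> card (\<Union>v\<in>A. I v)"
    using fin by (intro card_mono) (auto simp: I_def)
  ultimately show ?thesis by linarith
qed

text \<open>Bipartite graphs without isolated vertices inject into the strongly graded posets; the
  others are counted by \<open>card_bip_isolated\<close>.\<close>

lemma num_strongly_graded_ge:
  "bip_count n \<le> num_strongly_graded n + n * (2 * bip_count (n - 1))"
proof -
  let ?A = "{1..n}"
  let ?B = "{(S, G) \<in> bip_graphs ?A. ?A \<subseteq> Field G}" and ?I = "{(S, G) \<in> bip_graphs ?A. \<not> ?A \<subseteq> Field G}"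
  let ?h = "\<lambda>(S :: nat set, G). Id_on ?A \<union> G"
  have "inj_on ?h ?B"
  proof (rule inj_onI, clarify)
    fix S G S' G'
    assume *: "(S, G) \<in> bip_graphs ?A" "?A \<subseteq> Field G" "(S', G') \<in> bip_graphs ?A" "?A \<subseteq> Field G'"
      and eq: "Id_on ?A \<union> G = Id_on ?A \<union> G'"
    have "G = (Id_on ?A \<union> G) - Id" "G' = (Id_on ?A \<union> G') - Id"
      using *(1,3) unfolding bip_graphs_def by auto
    then have "G = G'" using eq by simp
    \<comment> \<open>Without isolated vertices the edges determine the side, which gives
      injectivity.\<close>
    moreover have "S = Domain G" "S' = Domain G'"
      using * unfolding bip_graphs_def Field_def by blast+
    ultimately show "S = S' \<and> G = G'" by simp
  qed
  moreover have "?h ` ?B \<subseteq> {r. partial_order_on ?A r \<and> strongly_graded ?A r \<and> avoids_3_plus_1 ?A r}"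
  proof clarify
    fix S G assume "(S, G) \<in> bip_graphs ?A" "?A \<subseteq> Field G"
    from bip_poset[OF this] show "partial_order_on ?A (Id_on ?A \<union> G) \<and>
        strongly_graded ?A (Id_on ?A \<union> G) \<and> avoids_3_plus_1 ?A (Id_on ?A \<union> G)" by simp
  qed
  ultimately have "card ?B \<le> num_strongly_graded n"
    unfolding num_strongly_graded_def by (rule card_inj_on_le) (simp add: finite_posets)
  moreover have "card ?I \<le> n * (2 * bip_count (n - 1))" by (rule card_bip_isolated) auto
  moreover have "bip_graphs ?A = ?B \<union> ?I" by blast
  then have "card (bip_graphs ?A) \<le> card ?B + card ?I"
    using card_Un_le[of ?B ?I] by simp
  ultimately show ?thesis by (simp add: card_bip_graphs)
qed

text \<open>The strict order is a bipartite graph from the minimal elements to the others; isolated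
  elements go to the lower side, and an injection suffices for this bound.\<close>

lemma card_chain_free_posets:
  assumes "finite A"
  shows "card {r. partial_order_on A r \<and> (\<nexists>x y z. strictly_below r x y \<and> strictly_below r y z)}
    \<le> bip_count (card A)"
proof -
  let ?P = "{r. partial_order_on A r \<and> (\<nexists>x y z. strictly_below r x y \<and> strictly_below r y z)}"
  let ?h = "\<lambda>r. (A - Range (r - Id), r - Id)"
  have r: "Id_on A \<subseteq> r" "r \<subseteq> A \<times> A" if "partial_order_on A r" for r
    using that unfolding partial_order_on_def preorder_on_def refl_on_def by auto
  have "inj_on ?h ?P"
  proof (rule inj_onI)
    fix r r' assume *: "r \<in> ?P" "r' \<in> ?P" "?h r = ?h r'"
    have "q = Id_on A \<union> (q - Id)" if "q \<in> ?P" for q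
    proof -
      have "partial_order_on A q" using that by simp
      from r[OF this] show ?thesis by auto
    qed
    from this[OF *(1)] this[OF *(2)] show "r = r'" using *(3) by simp
  qed
  moreover have "?h ` ?P \<subseteq> bip_graphs A"
  proof clarify
    fix r assume P: "partial_order_on A r" "\<nexists>x y z. strictly_below r x y \<and> strictly_below r y z"
    have "a \<in> A \<and> b \<in> A \<and> a \<notin> Range (r - Id) \<and> b \<in> Range (r - Id)" if "(a, b) \<in> r - Id" for a b
      using r(2)[OF P(1)] P(2) that unfolding strictly_below_def by blast
    then show "?h r \<in> bip_graphs A" unfolding bip_graphs_def by auto
  qed
  ultimately have "card ?P \<le> card (bip_graphs A)"
    using finite_bip_graphs[OF assms] by (rule card_inj_on_le)
  then show ?thesis by (simp add: card_bip_graphs assms)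
qed

section \<open>Graded posets with a chain of three elements\<close>

text \<open>Reconstructs a poset from its rank function and its comparabilities between consecutive ranks,
  given that elements whose ranks differ by at least 2 are comparable.\<close>

definition order_of_layers :: "'a set \<Rightarrow> ('a \<Rightarrow> nat) \<times> 'a rel \<Rightarrow> 'a rel" where
  "order_of_layers A = (\<lambda>(f, G). {(a, b) \<in> A \<times> A. a = b \<or> f a + 2 \<le> f b \<or> (a, b) \<in> G})"

locale graded_avoiding_poset =
  fixes A :: "'a set" and r :: "'a rel" and rk :: "'a \<Rightarrow> nat"
  assumes fin: "finite A" and po: "partial_order_on A r"
    and rank: "rank_function A r rk" and avoid: "avoids_3_plus_1 A r"
begin

lemma in_A: "(a, b) \<in> r \<Longrightarrow> a \<in> A \<and> b \<in> A"
  using po unfolding partial_order_on_def preorder_on_def by blast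

lemma le_refl: "a \<in> A \<Longrightarrow> (a, a) \<in> r"
  using po unfolding partial_order_on_def preorder_on_def refl_on_def by blast

lemma le_trans: "(a, b) \<in> r \<Longrightarrow> (b, c) \<in> r \<Longrightarrow> (a, c) \<in> r"
  using po unfolding partial_order_on_def preorder_on_def by (blast dest: transD)

lemma le_antisym: "(a, b) \<in> r \<Longrightarrow> (b, a) \<in> r \<Longrightarrow> a = b"
  using po unfolding partial_order_on_def by (blast dest: antisymD)

text \<open>Induction on the number of elements strictly between: with none, \<open>b\<close> covers
  \<open>a\<close>; otherwise such an element splits the interval, and the two ranges of ranks join
  up.\<close>

lemma rank_between_aux:
  assumes "(a, b) \<in> r" "a \<noteq> b"
  shows "rk a < rk b \<and> (\<forall>k. rk a < k \<and> k \<le> rk b \<longrightarrow> (\<exists>c. (a, c) \<in> r \<and> a \<noteq> c \<and> (c, b) \<in> r \<and> rk c = k))"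
  using assms
proof (induction "card {c. strictly_below r a c \<and> strictly_below r c b}" arbitrary: a b rule: less_induct)
  case less
  let ?I = "\<lambda>a b. {c. strictly_below r a c \<and> strictly_below r c b}"
  have finI: "finite (?I a b)" for a b
    by (rule finite_subset[OF _ fin]) (auto simp: strictly_below_def dest: in_A)
  show ?case
  proof (cases "?I a b = {}")
    case True
    then have "covers r b a" using less.prems unfolding covers_def strictly_below_def by blast
    then have "rk b = rk a + 1"
      using rank in_A[OF less.prems(1)] unfolding rank_function_def by blast
    moreover have "(b, b) \<in> r" using le_refl in_A[OF less.prems(1)] by blast
    moreover have "k = rk b" if "rk a < k" "k \<le> rk b" for k
      using that \<open>rk b = rk a + 1\<close> by linarith
    ultimately show ?thesis using less.prems by auto
  next
    case False
    then obtain c where c: "(a, c) \<in> r" "a \<noteq> c" "(c, b) \<in> r" "c \<noteq> b"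
      unfolding strictly_below_def by blast
    have "?I a c \<subseteq> ?I a b" "?I c b \<subseteq> ?I a b"
      unfolding strictly_below_def using c le_trans le_antisym by blast+
    moreover have "c \<in> ?I a b" "c \<notin> ?I a c" "c \<notin> ?I c b"
      unfolding strictly_below_def using c by blast+
    ultimately have "?I a c \<subset> ?I a b" "?I c b \<subset> ?I a b" by blast+
    then have "card (?I a c) < card (?I a b)" "card (?I c b) < card (?I a b)"
      using psubset_card_mono[OF finI] by blast+
    note IH = less.hyps[OF this(1) c(1,2)] less.hyps[OF this(2) c(3,4)]
    have "\<exists>d. (a, d) \<in> r \<and> a \<noteq> d \<and> (d, b) \<in> r \<and> rk d = k" if k: "rk a < k" "k \<le> rk b" for k
    proof (cases "k \<le> rk c")
      case True
      then obtain d where "(a, d) \<in> r" "a \<noteq> d" "(d, c) \<in> r" "rk d = k" using IH(1) k by blast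
      then show ?thesis using le_trans[OF _ c(3)] by blast
    next
      case False
      then have "rk c < k" by simp
      then obtain d where d: "(c, d) \<in> r" "(d, b) \<in> r" "rk d = k" using IH(2) k by blast
      then show ?thesis using le_trans[OF c(1)] k by blast
    qed
    then show ?thesis using IH by auto
  qed
qed

lemma rank_less: "(a, b) \<in> r \<Longrightarrow> a \<noteq> b \<Longrightarrow> rk a < rk b"
  using rank_between_aux by blast

lemma rank_le: "(a, b) \<in> r \<Longrightarrow> rk a \<le> rk b"
  using rank_less by (cases "a = b") (auto intro: less_imp_le)

lemma rank_eq: "(a, b) \<in> r \<Longrightarrow> rk b \<le> rk a \<Longrightarrow> a = b"
  using rank_less leD by blast

lemma rank_between:
  assumes "(a, b) \<in> r" "rk a \<le> k" "k \<le> rk b"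
  obtains c where "(a, c) \<in> r" "(c, b) \<in> r" "rk c = k"
proof (cases "rk a = k")
  case True
  then show ?thesis using that[of a] assms le_refl in_A by blast
next
  case False
  then have "a \<noteq> b" "rk a < k" using assms by auto
  then show ?thesis using rank_between_aux[OF assms(1)] assms(3) that by blast
qed

text \<open>The interval from \<open>a\<close> to \<open>b\<close> contains a chain of ranks
  \<open>k\<close>, \<open>k + 1\<close>, \<open>k + 2\<close>, which together with \<open>w\<close>
  would be a forbidden (3+1).\<close>

lemma not_chain_incomparable:
  assumes "w \<in> A" "(a, b) \<in> r" "rk a \<le> k" "k + 2 \<le> rk b"
    and "\<And>c. \<lbrakk>(a, c) \<in> r; (c, b) \<in> r; k \<le> rk c; rk c \<le> k + 2\<rbrakk> \<Longrightarrow> (c, w) \<notin> r \<and> (w, c) \<notin> r"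
  shows False
proof -
  obtain x where x: "(a, x) \<in> r" "(x, b) \<in> r" "rk x = k"
    using rank_between[OF assms(2,3)] assms(4) by auto
  obtain y where y: "(x, y) \<in> r" "(y, b) \<in> r" "rk y = k + 1"
    using rank_between[OF x(2), of "k + 1"] x(3) assms(4) by auto
  obtain z where z: "(y, z) \<in> r" "(z, b) \<in> r" "rk z = k + 2"
    using rank_between[OF y(2), of "k + 2"] y(3) assms(4) by auto
  have "strictly_below r x y" "strictly_below r y z"
    using x y z unfolding strictly_below_def by auto
  moreover have "incomparable r w x" "incomparable r w y" "incomparable r w z"
    using assms(5)[of x] assms(5)[of y] assms(5)[of z] x y z le_trans[OF x(1) y(1)] le_trans[OF le_trans[OF x(1) y(1)] z(1)]
    unfolding incomparable_def by simp_all
  ultimately show False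
    using avoid assms(1) in_A[OF y(1)] in_A[OF z(1)] unfolding avoids_3_plus_1_def by blast
qed

text \<open>If \<open>a\<close> and \<open>b\<close> were incomparable, then either the chain from \<open>a\<close> up to \<open>v'\<close> would contain three
  elements incomparable to \<open>b\<close>, or the chain from \<open>v\<close> up to \<open>b\<close> three elements incomparable to \<open>a\<close>.\<close>

lemma below_of_rank_gap_step:
  assumes b: "b \<in> A" and v: "(v, v') \<in> r \<union> r\<inverse>"
    and IH: "\<And>a. (a, v) \<in> r \<Longrightarrow> rk a + 2 \<le> rk b \<Longrightarrow> (a, b) \<in> r"
    and a: "(a, v') \<in> r" "rk a + 2 \<le> rk b"
  shows "(a, b) \<in> r"
proof (cases "(v', v) \<in> r")
  case True
  then show ?thesis using IH a le_trans by blast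
next
  case False
  then have v: "(v, v') \<in> r" and "v \<noteq> v'" using v le_refl[of v'] in_A[OF a(1)] by auto
  show ?thesis
  proof (rule ccontr)
    assume n: "(a, b) \<notin> r"
    show False
    \<comment> \<open>If the chain from \<open>a\<close> to \<open>v'\<close> is too short,
      \<open>v\<close> has rank at most \<open>rk a\<close>; then \<open>IH\<close> puts
      \<open>v\<close> below \<open>b\<close>, and the chain from \<open>v\<close> to
      \<open>b\<close> passes through the ranks from \<open>rk a\<close> to
      \<open>rk a + 2\<close>.\<close>
    proof (cases "rk a + 2 \<le> rk v'")
      case True
      show False
      proof (rule not_chain_incomparable[OF b a(1) order_refl True])
        fix c assume c: "(a, c) \<in> r" "rk c \<le> rk a + 2"
        then have "(c, b) \<notin> r" using n le_trans by blast
        \<comment> \<open>Since \<open>rk c \<le> rk b\<close>, having \<open>b\<close> below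
          \<open>c\<close> would mean \<open>b = c\<close>.\<close>
        moreover have "(b, c) \<notin> r"
          using rank_eq[of b c] c(2) a(2) \<open>(c, b) \<notin> r\<close> by auto
        ultimately show "(c, b) \<notin> r \<and> (b, c) \<notin> r" ..
      qed
    next
      case False
      then have va: "rk v \<le> rk a" using rank_less[OF v \<open>v \<noteq> v'\<close>] by simp
      then have vb: "(v, b) \<in> r" using IH[of v] le_refl[of v] in_A[OF v] a(2) by simp
      show False
      proof (rule not_chain_incomparable[OF _ vb va a(2)])
        show "a \<in> A" using in_A[OF a(1)] by simp
        fix c assume c: "(c, b) \<in> r" "rk a \<le> rk c"
        then have "(a, c) \<notin> r" using n le_trans by blast
        moreover have "(c, a) \<notin> r"
          using rank_eq[of c a] c(2) \<open>(a, c) \<notin> r\<close> by auto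
        ultimately show "(c, a) \<notin> r \<and> (a, c) \<notin> r" by simp
      qed
    qed
  qed
qed

text \<open>Induction along a path of comparabilities that starts at \<open>b\<close>, where the
  claim is trivial.\<close>

lemma below_of_rank_gap:
  assumes "(b, v) \<in> (r \<union> r\<inverse>)\<^sup>*" "b \<in> A" "(a, v) \<in> r" "rk a + 2 \<le> rk b"
  shows "(a, b) \<in> r"
  using assms(1,3,4)
proof (induction arbitrary: a rule: rtrancl_induct)
  case (step v v')
  show ?case using below_of_rank_gap_step[OF assms(2) step.hyps(2) step.IH step.prems] .
qed

text \<open>By avoidance every element is comparable to \<open>x\<close>, \<open>y\<close> or
  \<open>z\<close>, and hence linked to \<open>y\<close>.\<close>

lemma connected_of_chain:
  assumes "strictly_below r x y" "strictly_below r y z" "v \<in> A" "w \<in> A"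
  shows "(v, w) \<in> (r \<union> r\<inverse>)\<^sup>*"
proof -
  let ?R = "(r \<union> r\<inverse>)\<^sup>*"
  have le: "(x, y) \<in> r" "(y, z) \<in> r" using assms(1,2) unfolding strictly_below_def by auto
  have sym: "sym ?R" by (intro sym_rtrancl symI) auto
  have y: "(y, u) \<in> ?R" if "u \<in> A" for u
  proof -
    have "\<exists>c. c \<in> {x, y, z} \<and> (c, u) \<in> r \<union> r\<inverse>"
      using avoid assms(1,2) that in_A[OF le(1)] in_A[OF le(2)]
      unfolding avoids_3_plus_1_def incomparable_def by blast
    then obtain c where "c \<in> {x, y, z}" "(c, u) \<in> r \<union> r\<inverse>" by blast
    moreover have "(y, c) \<in> ?R" if "c \<in> {x, y, z}" for c using that le by auto
    ultimately show ?thesis by (meson rtrancl.rtrancl_into_rtrancl)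
  qed
  have "(v, y) \<in> ?R" using symD[OF sym y[OF assms(3)]] .
  then show ?thesis using y[OF assms(4)] by (rule rtrancl_trans)
qed

text \<open>A chain makes the poset connected, so a rank gap of 2 forces comparability, and
  \<open>r\<close> is recovered from its ranks and the comparabilities between consecutive
  ranks.\<close>

lemma encoded_in_spread:
  assumes chain: "strictly_below r x y" "strictly_below r y z"
  shows "r \<in> order_of_layers A ` spread A (card A)"
proof -
  have le: "(x, y) \<in> r" "x \<noteq> y" "(y, z) \<in> r" "y \<noteq> z" using chain unfolding strictly_below_def by auto
  then have xyz: "x \<in> A" "y \<in> A" "z \<in> A" using in_A by blast+
  have gap: "(a, b) \<in> r" if "a \<in> A" "b \<in> A" "rk a + 2 \<le> rk b" for a b
    using below_of_rank_gap[OF connected_of_chain[OF chain that(2,1)] that(2) le_refl[OF that(1)] that(3)] .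
  have "\<exists>m\<in>A. rk m = 0"
  proof -
    let ?C = "(r \<union> r\<inverse>)\<^sup>* `` {x}"
    have "?C \<in> poset_components A r" unfolding poset_components_def using xyz(1) by (rule quotientI)
    then have "Min (rk ` ?C) = 0" using rank unfolding rank_function_def by blast
    moreover have "?C \<subseteq> A"
    proof
      fix u assume "u \<in> ?C"
      then have "(x, u) \<in> (r \<union> r\<inverse>)\<^sup>*" by simp
      then show "u \<in> A" by (cases rule: rtranclE) (use xyz(1) in_A in blast)+
    qed
    moreover have "x \<in> ?C" by simp
    then have "rk ` ?C \<noteq> {}" by blast
    moreover have "finite (rk ` ?C)" using finite_subset[OF \<open>?C \<subseteq> A\<close> fin] by (rule finite_imageI)
    ultimately have "0 \<in> rk ` ?C" using Min_in[of "rk ` ?C"] by simp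
    then show ?thesis using \<open>?C \<subseteq> A\<close> by force
  qed
  then obtain m where m: "m \<in> A" "rk m = 0" by blast
  \<comment> \<open>An element of rank at least 2 lies above \<open>m\<close>, so all ranks from 0
    up to its own are attained in \<open>A\<close>.\<close>
  have bound: "rk v \<le> card A" if "v \<in> A" for v
  proof (cases "2 \<le> rk v")
    case True
    then have "(m, v) \<in> r" using gap[OF m(1) that] m(2) by simp
    have "{..rk v} \<subseteq> rk ` A"
    proof
      fix k assume "k \<in> {..rk v}"
      then obtain c where "(m, c) \<in> r" "rk c = k" using rank_between[OF \<open>(m, v) \<in> r\<close>, of k] m(2) by auto
      then show "k \<in> rk ` A" using in_A by blast
    qed
    then have "card {..rk v} \<le> card (rk ` A)" using fin by (intro card_mono) auto
    also have "\<dots> \<le> card A" using fin by (rule card_image_le)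
    finally show ?thesis by simp
  next
    case False
    have "card A > 0" using fin that by (auto simp: card_gt_0_iff)
    then show ?thesis using False by linarith
  qed
  \<comment> \<open>\<open>rk\<close> is arbitrary off \<open>A\<close>, while
    \<open>layered\<close> asks for extensional functions.\<close>
  define f where "f = restrict rk A"
  define G where "G = {(a, b) \<in> r. rk b = rk a + 1}"
  have f: "f a = rk a" if "a \<in> A" for a using that by (simp add: f_def)
  have "(f, G) \<in> layered A (card A)"
    unfolding layered_def mem_Collect_eq prod.case
  proof (intro conjI ballI impI)
    show "f \<in> A \<rightarrow>\<^sub>E {..card A}" using bound unfolding f_def by auto
    show "G \<subseteq> {(a, b) \<in> A \<times> A. f b = f a + 1}"
    proof (rule subrelI)
      fix a b assume "(a, b) \<in> G"
      then have "(a, b) \<in> r" "rk b = rk a + 1" unfolding G_def by auto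
      then show "(a, b) \<in> {(a, b) \<in> A \<times> A. f b = f a + 1}" using in_A[of a b] f by simp
    qed
    fix p q assume pq: "p \<in> A" "q \<in> A" "f p = f q"
    then have eq: "rk p = rk q" using f by simp
    show "G\<inverse> `` {p} \<subseteq> G\<inverse> `` {q} \<or> G `` {p} \<subseteq> G `` {q}"
    proof (rule ccontr)
      assume "\<not> ?thesis"
      \<comment> \<open>The chain \<open>s\<close>, \<open>p\<close>, \<open>t\<close> and the
        element \<open>q\<close>, which has the rank of \<open>p\<close>, would form a
        (3+1).\<close>
      then obtain s t where "(s, p) \<in> G" "(s, q) \<notin> G" "(p, t) \<in> G" "(q, t) \<notin> G" by blast
      then have s: "(s, p) \<in> r" "rk p = rk s + 1" "(s, q) \<notin> r" and t: "(p, t) \<in> r" "rk t = rk p + 1" "(q, t) \<notin> r"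
        using eq unfolding G_def by auto
      have "(q, s) \<notin> r" "(t, q) \<notin> r" using rank_le[of q s] rank_le[of t q] s t eq by auto
      moreover have "(p, q) \<notin> r" "(q, p) \<notin> r"
        using rank_eq[of p q] rank_eq[of q p] eq s by auto
      ultimately have "incomparable r q s" "incomparable r q p" "incomparable r q t"
        using s t unfolding incomparable_def by auto
      moreover have "strictly_below r s p" "strictly_below r p t"
        using s t unfolding strictly_below_def by auto
      ultimately show False
        using avoid pq in_A[OF s(1)] in_A[OF t(1)] unfolding avoids_3_plus_1_def by blast
    qed
  qed
  moreover have "\<not> f ` A \<subseteq> {p, p + 1}" for p
  proof
    assume "f ` A \<subseteq> {p, p + 1}"
    then have "f x \<in> {p, p + 1}" "f y \<in> {p, p + 1}" "f z \<in> {p, p + 1}" using xyz by blast+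
    then show False using rank_less[OF le(1,2)] rank_less[OF le(3,4)] f xyz by auto
  qed
  ultimately have "(f, G) \<in> spread A (card A)" unfolding spread_def by blast
  moreover have "r = order_of_layers A (f, G)"
  proof (rule set_eqI, rule iffI)
    fix e assume "e \<in> r"
    then obtain a b where e: "e = (a, b)" "(a, b) \<in> r" by (cases e) auto
    then have ab: "a \<in> A" "b \<in> A" using in_A by blast+
    have "a = b \<or> rk a + 2 \<le> rk b \<or> rk b = rk a + 1" using rank_less[OF e(2)] by linarith
    then show "e \<in> order_of_layers A (f, G)"
      using e ab f unfolding order_of_layers_def G_def by auto
  next
    fix e assume "e \<in> order_of_layers A (f, G)"
    then show "e \<in> r"
      using gap le_refl f unfolding order_of_layers_def G_def by auto
  qed
  ultimately show ?thesis by (rule rev_image_eqI)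
qed

end

section \<open>Upper bound for the weakly graded posets and the final sandwich\<close>

lemma num_weakly_graded_le: "num_weakly_graded n \<le> bip_count n + card (spread {1..n} n)"
proof -
  let ?A = "{1..n}"
  let ?F = "{r. partial_order_on ?A r \<and> (\<nexists>x y z. strictly_below r x y \<and> strictly_below r y z)}"
  have fin: "finite (spread ?A n)"
    by (rule finite_subset[OF _ finite_layered[of ?A n]]) (auto simp: spread_def)
  have "{r. partial_order_on ?A r \<and> weakly_graded ?A r \<and> avoids_3_plus_1 ?A r}
    \<subseteq> ?F \<union> order_of_layers ?A ` spread ?A n"
  proof
    fix r assume r: "r \<in> {r. partial_order_on ?A r \<and> weakly_graded ?A r \<and> avoids_3_plus_1 ?A r}"
    then obtain rk where "rank_function ?A r rk" unfolding weakly_graded_def by blast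
    then interpret graded_avoiding_poset ?A r rk
      using r by unfold_locales auto
    show "r \<in> ?F \<union> order_of_layers ?A ` spread ?A n"
      using encoded_in_spread po by auto
  qed
  then have "num_weakly_graded n \<le> card (?F \<union> order_of_layers ?A ` spread ?A n)"
    unfolding num_weakly_graded_def using fin finite_posets[of ?A] by (intro card_mono) auto
  also have "\<dots> \<le> card ?F + card (order_of_layers ?A ` spread ?A n)" by (rule card_Un_le)
  also have "\<dots> \<le> bip_count n + card (spread ?A n)"
    using card_chain_free_posets[of ?A] card_image_le[OF fin] by (intro add_mono) auto
  finally show ?thesis .
qed

lemma num_strongly_le_weakly: "num_strongly_graded n \<le> num_weakly_graded n"
  unfolding num_strongly_graded_def num_weakly_graded_def
  by (intro card_mono finite_posets) (auto simp: strongly_graded_def weakly_graded_def)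

text \<open>Eventually both quotients by \<open>bip_count n\<close> lie between \<open>lo n\<close>
  and \<open>1 + \<eta> n\<close>, the strongly graded one being the smaller.\<close>

lemma asymp_bip_count:
  "(\<lambda>n. real (num_strongly_graded n)) \<sim>[at_top] (\<lambda>n. real (bip_count n))"
  "(\<lambda>n. real (num_weakly_graded n)) \<sim>[at_top] (\<lambda>n. real (bip_count n))"
proof -
  obtain \<eta> :: "nat \<Rightarrow> real" where \<eta>: "\<eta> \<longlonglongrightarrow> 0"
    and spread: "\<forall>\<^sub>F n in at_top. real (card (spread {1..n} n)) \<le> \<eta> n * real (bip_count n)"
    by (rule spread_negligible)
  \<comment> \<open>The subtracted term bounds the fraction of graphs with an isolated vertex,
    \<open>2 * n * bip_count (n - 1) / bip_count n\<close>, by means of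
    \<open>bip_count_pred\<close>.\<close>
  define lo where "lo n = 1 - 2 * real n * 2 powr (- real n / 2)" for n
  have lo: "lo \<longlonglongrightarrow> 1" unfolding lo_def by real_asymp
  have hi: "(\<lambda>n. 1 + \<eta> n) \<longlonglongrightarrow> 1" using tendsto_add[OF tendsto_const \<eta>, of 1] by simp
  have pos: "real (bip_count n) > 0" for n using bip_count_pos[of n] by simp
  have lower: "\<forall>\<^sub>F n in at_top. lo n \<le> real (num_strongly_graded n) / real (bip_count n)"
    using eventually_ge_at_top[of 1]
  proof eventually_elim
    case (elim n)
    have "real (bip_count n) \<le> real (num_strongly_graded n + n * (2 * bip_count (n - 1)))"
      using num_strongly_graded_ge by (subst of_nat_le_iff)
    also have "\<dots> = real (num_strongly_graded n) + 2 * real n * real (bip_count (n - 1))" by simp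
    also have "\<dots> \<le> real (num_strongly_graded n) + 2 * real n * (real (bip_count n) * 2 powr (- real n / 2))"
      by (intro add_left_mono mult_left_mono bip_count_pred[OF elim]) auto
    finally show ?case using pos[of n] by (simp add: lo_def field_simps)
  qed
  have upper: "\<forall>\<^sub>F n in at_top. real (num_weakly_graded n) / real (bip_count n) \<le> 1 + \<eta> n"
    using spread
  proof eventually_elim
    case (elim n)
    have "real (num_weakly_graded n) \<le> real (bip_count n + card (spread {1..n} n))"
      using num_weakly_graded_le by (subst of_nat_le_iff)
    also have "\<dots> \<le> (1 + \<eta> n) * real (bip_count n)" using elim by (simp add: algebra_simps)
    finally show ?case using pos[of n] by (simp add: pos_divide_le_eq)
  qed
  have mid: "real (num_strongly_graded n) / real (bip_count n) \<le> real (num_weakly_graded n) / real (bip_count n)" for n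
    using num_strongly_le_weakly[of n] by (intro divide_right_mono) auto
  show "(\<lambda>n. real (num_strongly_graded n)) \<sim>[at_top] (\<lambda>n. real (bip_count n))"
  proof (rule asymp_equivI', rule tendsto_sandwich[OF lower _ lo hi])
    show "\<forall>\<^sub>F n in at_top. real (num_strongly_graded n) / real (bip_count n) \<le> 1 + \<eta> n"
      using upper by (rule eventually_mono) (use mid order_trans in blast)
  qed
  show "(\<lambda>n. real (num_weakly_graded n)) \<sim>[at_top] (\<lambda>n. real (bip_count n))"
  proof (rule asymp_equivI', rule tendsto_sandwich[OF _ upper lo hi])
    show "\<forall>\<^sub>F n in at_top. lo n \<le> real (num_weakly_graded n) / real (bip_count n)"
      using lower by (rule eventually_mono) (use mid order_trans in blast)
  qed
qed

theorem theorem9p2: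
  shows "(\<lambda>n. real (num_strongly_graded n)) \<sim>[at_top] (\<lambda>n. real (num_weakly_graded n)) \<and>
         (\<lambda>n. real (num_weakly_graded n)) \<sim>[at_top] (\<lambda>n. fact n * psi n)"
  using asymp_bip_count asymp_equiv_sym asymp_equiv_trans
  unfolding bip_count_psi by blast

end
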